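(* Let $H$ be a real or complex Hilbert space and let $H_1,\dots,H_n$ be closed subspaces of $H$. The following statements are true: (1) Assume that the system of subspaces $H_1,\dots,H_n$ possesses the IBAP. If $\{v^{(i)}_\alpha\mid\alpha\in M_i\}$ is a Riesz family in $H_i$ for $i=1,2,\dots,n$, then the family $\{v^{(i)}_\alpha\mid i=1,2,\dots,n,\ \alpha\in M_i\}$ is also a Riesz family. (2) Assume that for every $i=1,2,\dots,n$ a family of elements $\{v^{(i)}_\alpha\mid\alpha\in M_i\}$ of the subspace $H_i$ is such that the linear span of the family is dense in $H_i$. If the family of elements $\{v^{(i)}_\alpha\mid i=1,2,\dots,n,\ \alpha\in M_i\}$ is a Riesz family, then the system of subspaces $H_1,\dots,H_n$ possesses the IBAP.
   Context: Let $P_k$ be the orthogonal projection onto $H_k$. The system of closed subspaces $H_1,\dots,H_n$ possesses the inverse best approximation property (IBAP) if for arbitrary $x_1\in H_1,\dots,x_n\in H_n$ there exists $x\in H$ such that $P_kx=x_k$ for all $k=1,\dots,n$. A family $\{v_\alpha\mid\alpha\in M\}$ of elements of a Hilbert space $H$ is a Riesz basis for $H$ if there exist an orthonormal basis $\{e_\alpha\mid\alpha\in M\}$ of $H$ and an isomorphism $A:H\to H$ (a linear bijection, continuous with continuous inverse) such that $v_\alpha=Ae_\alpha$, $\alpha\in M$. A family is a Riesz family if it is a Riesz basis for the closure of the subspace spanned by it. The combined family $\{v^{(i)}_\alpha\mid i=1,\dots,n,\ \alpha\in M_i\}$ is indexed by the set of pairs $\bigcup_{i=1}^n\{i\}\times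 M_i$. *)

theory Defs
  imports "HOL-Analysis.Analysis"
begin

text \<open>
  The scalar field of a ``real or complex'' Hilbert space. The last axiom gives every scalar the
  form \<open>a + b * i\<close> with \<open>a\<close>, \<open>b\<close> real and \<open>i = 0\<close> or \<open>i * i = -1\<close>, so that up to isomorphism
  the only instances are \<open>real\<close>, with trivial conjugation, and \<open>complex\<close>, with \<open>cnj\<close>.
\<close>

class real_or_complex = real_normed_field +
  fixes conjugate :: "'a \<Rightarrow> 'a"
  assumes conjugate_add: "conjugate (a + b) = conjugate a + conjugate b"
    and conjugate_mult_self: "conjugate a * a = (norm a)\<^sup>2 *\<^sub>R 1"
    and ex_imaginary_unit:
      "\<exists>i. (i = 0 \<or> i * i = -1) \<and> (\<forall>c. \<exists>a b. c = a *\<^sub>R 1 + b *\<^sub>R i)"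

instantiation real :: real_or_complex
begin

definition conjugate_real :: "real \<Rightarrow> real" where
  "conjugate_real a = a"

instance
proof
  show "\<exists>i::real. (i = 0 \<or> i * i = -1) \<and> (\<forall>c. \<exists>a b. c = a *\<^sub>R 1 + b *\<^sub>R i)"
    by (intro exI[of _ 0]) simp
qed (simp_all add: conjugate_real_def power2_eq_square)

end

instantiation complex :: real_or_complex
begin

definition conjugate_complex :: "complex \<Rightarrow> complex" where
  "conjugate_complex a = cnj a"

instance
proof
  fix a b :: complex
  show "conjugate a * a = (norm a)\<^sup>2 *\<^sub>R 1"
    by (simp add: conjugate_complex_def scaleR_conv_of_real complex_norm_square mult.commute
        flip: of_real_power)
  have "\<forall>c. \<exists>a b. c = a *\<^sub>R 1 + b *\<^sub>R \<i>"
    by (metis complex_eq mult.commute mult.right_neutral scaleR_conv_of_real)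
  then show "\<exists>i::complex. (i = 0 \<or> i * i = -1) \<and> (\<forall>c. \<exists>a b. c = a *\<^sub>R 1 + b *\<^sub>R i)"
    by (intro exI[of _ \<i>]) simp
qed (simp add: conjugate_complex_def)

end

text \<open>
  The ambient Hilbert space is the whole type \<open>'h\<close>; its norm and topology come from the type
  classes and are tied to the inner product \<open>ip\<close> by \<open>ip_self\<close>. Inside the locale, \<open>span\<close> and
  \<open>subspace\<close> refer to the scalar multiplication \<open>scale\<close>, not to the real one.
\<close>

locale hilbert_space = vector_space scale
  for scale :: "'k::real_or_complex \<Rightarrow> 'h::{real_normed_vector, complete_space} \<Rightarrow> 'h" +
  fixes ip :: "'h \<Rightarrow> 'h \<Rightarrow> 'k"
  assumes scale_of_real: "scale (of_real r) x = r *\<^sub>R x"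
    and ip_add_left: "ip (x + y) z = ip x z + ip y z"
    and ip_scale_left: "ip (scale c x) y = c * ip x y"
    and ip_commute: "ip x y = conjugate (ip y x)"
    and ip_self: "ip x x = of_real ((norm x)\<^sup>2)"
begin

definition orth_proj :: "'h set \<Rightarrow> 'h \<Rightarrow> 'h" where
  "orth_proj S x = (THE p. p \<in> S \<and> (\<forall>s\<in>S. ip (x - p) s = 0))"

definition IBAP :: "nat \<Rightarrow> (nat \<Rightarrow> 'h set) \<Rightarrow> bool" where
  "IBAP n H \<longleftrightarrow>
    (\<forall>x. (\<forall>k\<in>{1..n}. x k \<in> H k) \<longrightarrow> (\<exists>y. \<forall>k\<in>{1..n}. orth_proj (H k) y = x k))"

text \<open>
  The following notions are relative to a closed subspace \<open>K\<close>, itself viewed as a Hilbert space.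
\<close>

definition orthonormal_basis :: "'h set \<Rightarrow> 'i set \<Rightarrow> ('i \<Rightarrow> 'h) \<Rightarrow> bool" where
  "orthonormal_basis K M e \<longleftrightarrow>
    (\<forall>\<alpha>\<in>M. e \<alpha> \<in> K) \<and>
    (\<forall>\<alpha>\<in>M. \<forall>\<beta>\<in>M. ip (e \<alpha>) (e \<beta>) = (if \<alpha> = \<beta> then 1 else 0)) \<and>
    closure (span (e ` M)) = K"

definition isomorphism_on :: "'h set \<Rightarrow> ('h \<Rightarrow> 'h) \<Rightarrow> bool" where
  "isomorphism_on K A \<longleftrightarrow>
    (\<forall>x\<in>K. \<forall>y\<in>K. A (x + y) = A x + A y) \<and>
    (\<forall>c. \<forall>x\<in>K. A (scale c x) = scale c (A x)) \<and>
    bij_betw A K K \<and> continuous_on K A \<and> continuous_on K (inv_into K A)"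

definition riesz_basis :: "'h set \<Rightarrow> 'i set \<Rightarrow> ('i \<Rightarrow> 'h) \<Rightarrow> bool" where
  "riesz_basis K M v \<longleftrightarrow>
    (\<exists>e A. orthonormal_basis K M e \<and> isomorphism_on K A \<and> (\<forall>\<alpha>\<in>M. v \<alpha> = A (e \<alpha>)))"

definition riesz_family :: "'i set \<Rightarrow> ('i \<Rightarrow> 'h) \<Rightarrow> bool" where
  "riesz_family M v \<longleftrightarrow> riesz_basis (closure (span (v ` M))) M v"

end

text \<open>
  Over \<open>real\<close>, the library's complete real inner product spaces are Hilbert spaces in this sense.
\<close>

lemma hilbert_space_real_inner:
  "hilbert_space (*\<^sub>R) (inner :: 'h::{real_inner, complete_space} \<Rightarrow> 'h \<Rightarrow> real)"
  by unfold_locales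
    (simp_all add: algebra_simps inner_commute conjugate_real_def power2_norm_eq_inner)

lemma hilbert_space_complex: "hilbert_space (*) (\<lambda>x y :: complex. x * cnj y)"
  by unfold_locales
    (simp_all add: algebra_simps conjugate_complex_def scaleR_conv_of_real complex_norm_square
      flip: of_real_power)

end

theory Submission
  imports Defs
begin

text \<open>
  A family is a Riesz family exactly when it becomes orthonormal under some isomorphism \<open>B\<close> of its
  closed span (\<open>riesz_family_iff_orthonormalizing_isomorphism\<close>). By \<open>renorming\<close>, it is enough
  that it be orthonormal for some Hermitian form equivalent to the inner product: such a form is
  \<open>ip x (G y)\<close> for a positive invertible operator \<open>G\<close>, and the self-adjoint square root of \<open>G\<close> is the
  required isomorphism.

  For the first part, the IBAP says that the map \<open>y \<mapsto> (P\<^sub>k y)\<^sub>k\<close> is onto the product of the \<open>H\<^sub>k\<close>. Its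
  adjoint is \<open>(f\<^sub>k)\<^sub>k \<mapsto> \<Sum>k. f\<^sub>k\<close>, which must therefore be bounded below; this is
  \<open>IBAP_imp_components_bounded\<close>, an application of the uniform boundedness principle. Hence the
  closed span of the combined family is the topological direct sum of the closed spans of the single
  families, and adding up the forms for which these are orthonormal gives an equivalent form for
  which the combined family is orthonormal (\<open>riesz_family_combine\<close>).

  For the second part, an isomorphism that orthonormalizes the combined family carries the \<open>H\<^sub>k\<close>
  into mutually orthogonal subspaces, where vectors with prescribed projections are sums; two
  applications of the Riesz representation theorem transport the solution back
  (\<open>IBAP_if_riesz_family\<close>).
\<close>

section \<open>Geometric convergence and conjugation\<close>

text \<open>
  The form of completeness behind both iterations below: the one for the square root and the one
  for the uniform boundedness principle. The explicit error bound matters for the latter.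
\<close>
lemma geometric_steps_converge:
  fixes x :: "nat \<Rightarrow> 'a::{real_normed_vector, complete_space}"
  assumes q: "0 \<le> q" "q < 1"
    and step: "\<And>n. norm (x (Suc n) - x n) \<le> C * q ^ n"
  obtains l where "x \<longlonglongrightarrow> l" "\<And>n. norm (l - x n) \<le> C * q ^ n / (1 - q)"
proof -
  have C: "0 \<le> C"
    using order_trans[OF norm_ge_zero step[of 0]] by simp
  have part: "norm (x (n + k) - x n) \<le> C * q ^ n * (1 - q ^ k) / (1 - q)" for n k
  proof (induction k)
    case 0
    then show ?case by simp
  next
    case (Suc k)
    have "norm (x (n + Suc k) - x n) \<le> norm (x (Suc (n + k)) - x (n + k)) + norm (x (n + k) - x n)"
      using norm_triangle_ineq[of "x (Suc (n + k)) - x (n + k)" "x (n + k) - x n"] by simp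
    also have "\<dots> \<le> C * q ^ (n + k) + C * q ^ n * (1 - q ^ k) / (1 - q)"
      using step[of "n + k"] Suc.IH by simp
    also have "\<dots> = C * q ^ n * (1 - q ^ Suc k) / (1 - q)"
      using q by (simp add: field_simps power_add)
    finally show ?case .
  qed
  have tail: "norm (x (n + k) - x n) \<le> C * q ^ n / (1 - q)" for n k
  proof -
    have "C * q ^ n * (1 - q ^ k) \<le> C * q ^ n * 1"
      using q C by (intro mult_left_mono) auto
    then have "C * q ^ n * (1 - q ^ k) / (1 - q) \<le> C * q ^ n / (1 - q)"
      using q by (intro divide_right_mono) auto
    with part[of n k] show ?thesis by linarith
  qed
  have null: "(\<lambda>n. C * q ^ n / (1 - q)) \<longlonglongrightarrow> 0"
    using q by (auto intro!: tendsto_eq_intros LIMSEQ_power_zero)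
  have "Cauchy x"
  proof (rule CauchyI')
    fix e :: real
    assume "0 < e"
    then obtain N where N: "\<And>n. n \<ge> N \<Longrightarrow> C * q ^ n / (1 - q) < e"
      using order_tendstoD(2)[OF null] by (auto simp: eventually_sequentially)
    have "dist (x m) (x n) < e" if "m \<ge> N" "n > m" for m n
      using tail[of m "n - m"] N[of m] that by (simp add: dist_norm norm_minus_commute)
    then show "\<exists>M. \<forall>m\<ge>M. \<forall>n>m. dist (x m) (x n) < e" by blast
  qed
  then obtain l where l: "x \<longlonglongrightarrow> l"
    using Cauchy_convergent convergent_def by blast
  have "norm (l - x n) \<le> C * q ^ n / (1 - q)" for n
  proof (rule tendsto_upperbound)
    show "(\<lambda>k. norm (x (k + n) - x n)) \<longlonglongrightarrow> norm (l - x n)"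
      by (intro tendsto_intros LIMSEQ_ignore_initial_segment l)
    show "\<forall>\<^sub>F k in sequentially. norm (x (k + n) - x n) \<le> C * q ^ n / (1 - q)"
      using tail[of n] by (simp add: add.commute)
  qed simp
  with l show thesis by (rule that)
qed

lemma conjugate_0 [simp]: "conjugate 0 = (0::'k::real_or_complex)"
  using conjugate_add[of 0 "0::'k"] by simp

lemma conjugate_minus: "conjugate (- a) = - conjugate (a::'k::real_or_complex)"
  using conjugate_add[of a "- a"] by (simp add: eq_neg_iff_add_eq_0 add.commute)

lemma conjugate_diff: "conjugate (a - b) = conjugate a - conjugate (b::'k::real_or_complex)"
  using conjugate_add[of a "- b"] by (simp add: conjugate_minus)

lemma conjugate_self_mult:
  "conjugate a * a = of_real ((norm (a::'k::real_or_complex))\<^sup>2)"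
  by (simp only: conjugate_mult_self of_real_def)

text \<open>
  The axioms give conjugation only through \<open>conjugate a * a\<close>, but that determines it where
  \<open>a \<noteq> 0\<close>. So it is multiplicative, an involution, and
  fixes the reals.
\<close>
lemma conjugate_eqI:
  assumes "b * a = of_real ((norm (a::'k::real_or_complex))\<^sup>2)" "a \<noteq> 0"
  shows "conjugate a = b"
  using assms conjugate_self_mult[of a] by (metis mult_right_cancel)

lemma conjugate_mult: "conjugate (a * b) = conjugate a * conjugate (b::'k::real_or_complex)"
proof (cases "a * b = 0")
  case False
  have "conjugate a * conjugate b * (a * b) = (conjugate a * a) * (conjugate b * b)"
    by (simp add: ac_simps)
  also have "\<dots> = of_real ((norm (a * b))\<^sup>2)"
    by (simp add: conjugate_self_mult norm_mult power_mult_distrib)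
  finally show ?thesis
    using False by (rule conjugate_eqI)
qed auto

lemma norm_conjugate [simp]: "norm (conjugate a) = norm (a::'k::real_or_complex)"
proof (cases "a = 0")
  case False
  have "norm (conjugate a) * norm a = (norm a)\<^sup>2"
    using arg_cong[OF conjugate_self_mult[of a], of norm]
    by (simp add: norm_mult norm_power)
  with False show ?thesis by (simp add: power2_eq_square)
qed simp

lemma conjugate_conjugate [simp]: "conjugate (conjugate a) = (a::'k::real_or_complex)"
proof (cases "a = 0")
  case False
  then have "conjugate a \<noteq> 0" by (metis norm_conjugate norm_eq_zero)
  then show ?thesis
    by (intro conjugate_eqI) (simp_all add: conjugate_self_mult mult.commute[of a])
qed simp

lemma conjugate_of_real [simp]: "conjugate (of_real r) = (of_real r :: 'k::real_or_complex)"
proof (cases "r = 0")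
  case False
  then show ?thesis
    by (intro conjugate_eqI) (simp_all add: power2_eq_square flip: of_real_mult)
qed simp

lemma conjugate_sum: "conjugate (sum f A) = (\<Sum>a\<in>A. conjugate (f a :: 'k::real_or_complex))"
  by (induction A rule: infinite_finite_induct) (simp_all add: conjugate_add)

section \<open>Geometry of the inner product\<close>

context hilbert_space
begin

lemma ip_zero_left [simp]: "ip 0 y = 0"
  using ip_add_left[of 0 0 y] by simp

lemma ip_minus_left: "ip (- x) y = - ip x y"
  using ip_add_left[of "- x" x y] by (simp add: eq_neg_iff_add_eq_0)

lemma ip_diff_left: "ip (x - y) z = ip x z - ip y z"
  using ip_add_left[of x "- y" z] by (simp add: ip_minus_left)

lemma ip_add_right: "ip x (y + z) = ip x y + ip x z"
  by (metis conjugate_add ip_add_left ip_commute)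

lemma ip_diff_right: "ip x (y - z) = ip x y - ip x z"
  by (metis conjugate_diff ip_diff_left ip_commute)

lemma ip_zero_right [simp]: "ip x 0 = 0"
  by (metis conjugate_0 ip_zero_left ip_commute)

lemma ip_scale_right: "ip x (scale c y) = conjugate c * ip x y"
  by (metis conjugate_mult ip_scale_left ip_commute)

lemma ip_scaleR_left: "ip (r *\<^sub>R x) y = of_real r * ip x y"
  by (metis scale_of_real ip_scale_left)

lemma ip_scaleR_right: "ip x (r *\<^sub>R y) = of_real r * ip x y"
  by (metis scale_of_real ip_scale_right conjugate_of_real)

lemma ip_sum_left: "ip (sum f A) y = (\<Sum>a\<in>A. ip (f a) y)"
  by (induction A rule: infinite_finite_induct) (simp_all add: ip_add_left)

lemma ip_sum_right: "ip x (sum f A) = (\<Sum>a\<in>A. ip x (f a))"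
  by (induction A rule: infinite_finite_induct) (simp_all add: ip_add_right)

lemma ip_self_eq_0_iff [simp]: "ip x x = 0 \<longleftrightarrow> x = 0"
  by (simp add: ip_self)

lemma norm_scale: "norm (scale c x) = norm c * norm x"
proof -
  have "of_real ((norm (scale c x))\<^sup>2) = (conjugate c * c) * ip x x"
    by (simp only: ip_self[symmetric] ip_scale_left ip_scale_right ac_simps)
  then have "of_real ((norm (scale c x))\<^sup>2) = (of_real ((norm c * norm x)\<^sup>2) :: 'k)"
    by (simp add: conjugate_self_mult ip_self power_mult_distrib)
  then have "(norm (scale c x))\<^sup>2 = (norm c * norm x)\<^sup>2"
    by (simp only: of_real_eq_iff)
  then show ?thesis by (simp add: power2_eq_iff_nonneg)
qed

text \<open>
  Pythagoras for the splitting of \<open>x\<close> along \<open>y\<close>. As the right-hand side is nonnegative this gives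
  the Cauchy--Schwarz inequality, and as it is smaller than \<open>(norm x)\<^sup>2\<close> unless \<open>ip x y = 0\<close> it gives the
  orthogonality of a nearest point.
\<close>
lemma norm_diff_component_sq:
  assumes "y \<noteq> 0"
  shows "(norm (x - scale (ip x y / ip y y) y))\<^sup>2 = (norm x)\<^sup>2 - (norm (ip x y))\<^sup>2 / (norm y)\<^sup>2"
proof -
  let ?c = "ip x y / ip y y"
  have 0: "ip (x - scale ?c y) y = 0"
    using assms by (simp add: ip_diff_left ip_scale_left)
  have "ip (x - scale ?c y) (x - scale ?c y) = ip (x - scale ?c y) x"
    by (simp add: ip_diff_right[of _ x] ip_scale_right 0)
  also have "\<dots> = ip x x - conjugate (ip x y) * ip x y / ip y y"
    by (simp add: ip_diff_left ip_scale_left ip_commute[of y x] mult.commute)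
  finally have "of_real ((norm (x - scale ?c y))\<^sup>2)
      = (of_real ((norm x)\<^sup>2 - (norm (ip x y))\<^sup>2 / (norm y)\<^sup>2) :: 'k)"
    by (simp only: ip_self conjugate_self_mult of_real_diff of_real_divide)
  then show ?thesis by (simp only: of_real_eq_iff)
qed

lemma cauchy_schwarz: "norm (ip x y) \<le> norm x * norm y"
proof (cases "y = 0")
  case False
  have "(norm (ip x y))\<^sup>2 / (norm y)\<^sup>2 \<le> (norm x)\<^sup>2"
    using norm_diff_component_sq[OF False, of x]
    by (smt (verit) zero_le_power2)
  then have "(norm (ip x y))\<^sup>2 \<le> (norm x * norm y)\<^sup>2"
    using False by (simp add: divide_simps power_mult_distrib)
  then show ?thesis by (rule power2_le_imp_le) simp
qed simp

lemma parallelogram: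
  fixes x y :: 'h
  shows "(norm (x + y))\<^sup>2 + (norm (x - y))\<^sup>2 = 2 * (norm x)\<^sup>2 + 2 * (norm y)\<^sup>2"
proof -
  have "ip (x + y) (x + y) + ip (x - y) (x - y) = 2 * ip x x + 2 * ip y y"
    by (simp add: ip_add_left ip_add_right ip_diff_left ip_diff_right)
  then have "of_real ((norm (x + y))\<^sup>2 + (norm (x - y))\<^sup>2)
      = (of_real (2 * (norm x)\<^sup>2 + 2 * (norm y)\<^sup>2) :: 'k)"
    by (simp only: ip_self of_real_add of_real_mult of_real_numeral)
  then show ?thesis by (simp only: of_real_eq_iff)
qed

lemma tendsto_ip_left:
  assumes "f \<longlonglongrightarrow> l"
  shows "(\<lambda>n. ip (f n) y) \<longlonglongrightarrow> ip l y"
proof (rule LIM_zero_cancel, rule tendsto_0_le)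
  show "(\<lambda>n. f n - l) \<longlonglongrightarrow> 0" using assms by (rule LIM_zero)
  show "\<forall>\<^sub>F n in sequentially. norm (ip (f n) y - ip l y) \<le> norm (f n - l) * norm y"
    using cauchy_schwarz by (simp add: flip: ip_diff_left)
qed

lemma tendsto_ip_right:
  assumes "f \<longlonglongrightarrow> l"
  shows "(\<lambda>n. ip y (f n)) \<longlonglongrightarrow> ip y l"
proof (rule LIM_zero_cancel, rule tendsto_0_le)
  show "(\<lambda>n. f n - l) \<longlonglongrightarrow> 0" using assms by (rule LIM_zero)
  show "\<forall>\<^sub>F n in sequentially. norm (ip y (f n) - ip y l) \<le> norm (f n - l) * norm y"
    using cauchy_schwarz by (simp add: mult.commute flip: ip_diff_right)
qed

lemma tendsto_scale:
  assumes "f \<longlonglongrightarrow> l"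
  shows "(\<lambda>n. scale c (f n)) \<longlonglongrightarrow> scale c l"
proof (rule LIM_zero_cancel, rule tendsto_0_le)
  show "(\<lambda>n. f n - l) \<longlonglongrightarrow> 0" using assms by (rule LIM_zero)
  show "\<forall>\<^sub>F n in sequentially. norm (scale c (f n) - scale c l) \<le> norm (f n - l) * norm c"
    by (simp add: norm_scale mult.commute flip: scale_right_diff_distrib)
qed

lemma scaleR_scale_commute: "r *\<^sub>R scale c x = scale c (r *\<^sub>R x)"
  by (simp add: mult.commute flip: scale_of_real)

lemma subspace_scaleR: "subspace S \<Longrightarrow> x \<in> S \<Longrightarrow> r *\<^sub>R x \<in> S"
  by (metis scale_of_real subspace_scale)

lemma subspace_closure:
  assumes "subspace S"
  shows "subspace (closure S)"
proof (rule subspaceI)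
  show "0 \<in> closure S"
    using subspace_0[OF assms] closure_subset by blast
next
  fix x y
  assume "x \<in> closure S" "y \<in> closure S"
  then obtain f g where "\<And>n. f n \<in> S" "f \<longlonglongrightarrow> x" "\<And>n. g n \<in> S" "g \<longlonglongrightarrow> y"
    by (auto simp: closure_sequential)
  then show "x + y \<in> closure S"
    unfolding closure_sequential
    by (intro exI[of _ "\<lambda>n. f n + g n"]) (auto intro: tendsto_add subspace_add[OF assms])
next
  fix c x
  assume "x \<in> closure S"
  then obtain f where "\<And>n. f n \<in> S" "f \<longlonglongrightarrow> x"
    by (auto simp: closure_sequential)
  then show "scale c x \<in> closure S"
    unfolding closure_sequential
    by (intro exI[of _ "\<lambda>n. scale c (f n)"]) (auto intro: tendsto_scale subspace_scale[OF assms])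
qed

lemma closed_span_minimal:
  assumes "subspace K" "closed K" "V \<subseteq> K"
  shows "closure (span V) \<subseteq> K"
  using assms by (intro closure_minimal span_minimal)

lemma in_closed_span: "x \<in> V \<Longrightarrow> x \<in> closure (span V)"
  using closure_subset span_base by blast

text \<open>
  The projection of \<open>x\<close> is its nearest point in \<open>S\<close>: by the parallelogram law, applied at the
  midpoint of two terms, a minimizing sequence is Cauchy.
\<close>
lemma projection_exists:
  assumes S: "subspace S" "closed S"
  obtains p where "p \<in> S" "\<And>s. s \<in> S \<Longrightarrow> ip (x - p) s = 0"
proof -
  define D where "D = (\<lambda>s. (norm (x - s))\<^sup>2) ` S"
  have D: "D \<noteq> {}" "bdd_below D"
    unfolding D_def using subspace_0[OF S(1)] by (auto intro!: bdd_belowI[of _ 0])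
  have le: "Inf D \<le> (norm (x - s))\<^sup>2" if "s \<in> S" for s
    using that D(2) by (auto simp: D_def intro: cInf_lower)
  have "\<exists>s\<in>S. (norm (x - s))\<^sup>2 < Inf D + 1 / real (Suc n)" for n
    using cInf_lessD[OF D(1), of "Inf D + 1 / real (Suc n)"] by (auto simp: D_def)
  then obtain s where s: "\<And>n. s n \<in> S" "\<And>n. (norm (x - s n))\<^sup>2 < Inf D + 1 / real (Suc n)"
    by metis
  \<comment> \<open>The midpoint of \<open>s m\<close> and \<open>s n\<close> lies in \<open>S\<close>, so it is no nearer to \<open>x\<close> than \<open>Inf D\<close> allows.\<close>
  have close: "(norm (s m - s n))\<^sup>2 \<le> 2 / real (Suc m) + 2 / real (Suc n)" for m n
  proof -
    let ?h = "(1/2) *\<^sub>R (s m + s n)"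
    have "?h \<in> S" using s S by (intro subspace_scaleR subspace_add)
    then have "4 * Inf D \<le> 4 * (norm (x - ?h))\<^sup>2" using le by simp
    also have "\<dots> = (norm (2 *\<^sub>R (x - ?h)))\<^sup>2" by (simp add: power_mult_distrib)
    also have "2 *\<^sub>R (x - ?h) = (x - s m) + (x - s n)"
      by (simp add: algebra_simps scaleR_2)
    finally have "4 * Inf D \<le> (norm ((x - s m) + (x - s n)))\<^sup>2" .
    moreover have "norm ((x - s m) - (x - s n)) = norm (s m - s n)"
      by (simp add: norm_minus_commute)
    ultimately show ?thesis
      using parallelogram[of "x - s m" "x - s n"] s(2)[of m] s(2)[of n] by simp
  qed
  have "Cauchy s"
  proof (rule CauchyI')
    fix e :: real
    assume e: "0 < e"
    then obtain N where N: "4 / e\<^sup>2 < real N" using reals_Archimedean2 by blast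
    have "dist (s m) (s n) < e" if "m \<ge> N" "n > m" for m n
    proof -
      have "4 / real (Suc N) < e\<^sup>2"
        using N e by (simp add: field_simps) (smt (verit) zero_less_power)
      moreover have "2 / real (Suc m) \<le> 2 / real (Suc N)" "2 / real (Suc n) \<le> 2 / real (Suc N)"
        using that by (simp_all add: frac_le)
      ultimately have "(norm (s m - s n))\<^sup>2 < e\<^sup>2" using close[of m n] by simp
      then show ?thesis using e by (simp add: dist_norm power2_less_imp_less)
    qed
    then show "\<exists>M. \<forall>m\<ge>M. \<forall>n>m. dist (s m) (s n) < e" by blast
  qed
  then obtain p where p: "s \<longlonglongrightarrow> p"
    using Cauchy_convergent convergent_def by blast
  have pS: "p \<in> S" using closed_sequentially[OF S(2) _ p] s(1) by blast
  have "(norm (x - p))\<^sup>2 \<le> Inf D"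
  proof (rule LIMSEQ_le)
    show "(\<lambda>n. (norm (x - s n))\<^sup>2) \<longlonglongrightarrow> (norm (x - p))\<^sup>2" by (intro tendsto_intros p)
    show "(\<lambda>n. Inf D + 1 / real (Suc n)) \<longlonglongrightarrow> Inf D"
      using tendsto_add[OF tendsto_const LIMSEQ_Suc[OF lim_1_over_n]] by simp
    show "\<exists>N. \<forall>n\<ge>N. (norm (x - s n))\<^sup>2 \<le> Inf D + 1 / real (Suc n)"
      using s(2) less_imp_le by blast
  qed
  then have min: "(norm (x - p))\<^sup>2 \<le> (norm (x - t))\<^sup>2" if "t \<in> S" for t
    using le[OF that] by (rule order_trans)
  have "ip (x - p) t = 0" if t: "t \<in> S" for t
  proof (cases "t = 0")
    case False
    let ?c = "ip (x - p) t / ip t t"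
    have "p + scale ?c t \<in> S" using S pS t by (intro subspace_add subspace_scale)
    from min[OF this] have "(norm (x - p))\<^sup>2 \<le> (norm (x - p - scale ?c t))\<^sup>2"
      by (simp add: diff_diff_eq)
    then have "(norm (ip (x - p) t))\<^sup>2 / (norm t)\<^sup>2 \<le> 0"
      by (simp add: norm_diff_component_sq[OF False])
    then show ?thesis using False by (simp add: divide_le_0_iff)
  qed simp
  with pS show thesis by (rule that)
qed

lemma ip_eqI:
  assumes "subspace K" "y \<in> K" "z \<in> K" "\<And>x. x \<in> K \<Longrightarrow> ip x y = ip x z"
  shows "y = z"
proof -
  have "ip (y - z) (y - z) = 0"
    using assms(4)[OF subspace_diff[OF assms(1-3)]] by (simp add: ip_diff_right)
  then show ?thesis by simp
qed

lemma orth_proj_eqI: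
  assumes "subspace S" "p \<in> S" "\<And>s. s \<in> S \<Longrightarrow> ip (x - p) s = 0"
  shows "orth_proj S x = p"
  unfolding orth_proj_def
proof (rule the_equality)
  fix p'
  assume p': "p' \<in> S \<and> (\<forall>s\<in>S. ip (x - p') s = 0)"
  show "p' = p"
  proof (rule ip_eqI[OF assms(1)])
    fix s
    assume "s \<in> S"
    then have "ip p' s = ip p s" using p' assms(3)[of s] by (simp add: ip_diff_left)
    then show "ip s p' = ip s p" by (metis ip_commute)
  qed (use p' assms in auto)
qed (use assms in auto)

lemma ip_orth_proj:
  assumes "subspace S" "closed S" "s \<in> S"
  shows "ip s (orth_proj S x) = ip s x"
proof -
  obtain p where p: "p \<in> S" "\<And>s. s \<in> S \<Longrightarrow> ip (x - p) s = 0"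
    using projection_exists[OF assms(1,2)] by blast
  have "ip p s = ip x s" using p(2)[OF assms(3)] by (simp add: ip_diff_left)
  then show ?thesis
    using orth_proj_eqI[OF assms(1) p] by (metis ip_commute)
qed

text \<open>
  The representing vector is a multiple of a vector \<open>w\<close> of \<open>K\<close> orthogonal to the kernel \<open>N\<close> of \<open>f\<close>,
  because \<open>x - (f x / f w) w\<close> always lies in \<open>N\<close>.
\<close>
lemma riesz_representation:
  assumes K: "subspace K" "closed K"
    and add: "\<And>x y. x \<in> K \<Longrightarrow> y \<in> K \<Longrightarrow> f (x + y) = f x + f y"
    and hom: "\<And>c x. x \<in> K \<Longrightarrow> f (scale c x) = c * f x"
    and bound: "\<And>x. x \<in> K \<Longrightarrow> norm (f x) \<le> C * norm x"
  obtains z where "z \<in> K" "\<And>x. x \<in> K \<Longrightarrow> f x = ip x z"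
proof (cases "\<forall>x\<in>K. f x = 0")
  case True
  then show thesis using that[of 0] subspace_0[OF K(1)] by simp
next
  case False
  then obtain x1 where x1: "x1 \<in> K" "f x1 \<noteq> 0" by blast
  have diff: "f (x - y) = f x - f y" if "x \<in> K" "y \<in> K" for x y
    using add[of "x - y" y] that K by (simp add: subspace_diff)
  have f0: "f 0 = 0" using hom[OF x1(1), of 0] by simp
  define N where "N = {x \<in> K. f x = 0}"
  have N: "subspace N"
    by (rule subspaceI)
      (auto simp: N_def add hom f0 subspace_0[OF K(1)] subspace_add[OF K(1)] subspace_scale[OF K(1)])
  have "closed N"
    unfolding closed_sequential_limits
  proof (intro allI impI)
    fix s l
    assume s: "(\<forall>n. s n \<in> N) \<and> s \<longlonglongrightarrow> l"
    have l: "l \<in> K" using closed_sequentially[OF K(2), of s l] s by (auto simp: N_def)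
    have "norm (f l) \<le> C * norm (l - s n)" for n
      using bound[of "l - s n"] diff[of l "s n"] s l K by (simp add: N_def subspace_diff)
    moreover have "(\<lambda>n. C * norm (l - s n)) \<longlonglongrightarrow> C * norm (l - l)"
      using s by (intro tendsto_intros) auto
    ultimately have "norm (f l) \<le> C * norm (l - l)"
      by (intro LIMSEQ_le_const) auto
    with l show "l \<in> N" by (simp add: N_def)
  qed
  then obtain p where p: "p \<in> N" "\<And>s. s \<in> N \<Longrightarrow> ip (x1 - p) s = 0"
    using projection_exists[OF N] by blast
  define w where "w = x1 - p"
  have w: "w \<in> K" "f w = f x1"
    using p(1) x1 K diff[of x1 p] by (auto simp: w_def N_def subspace_diff)
  then have "f w \<noteq> 0" "w \<noteq> 0" using x1 f0 by auto
  have wN: "ip s w = 0" if "s \<in> N" for s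
    using p(2)[OF that] by (metis conjugate_0 ip_commute w_def)
  show thesis
  proof (rule that)
    let ?c = "conjugate (f w / ip w w)"
    show "scale ?c w \<in> K" using w K by (simp add: subspace_scale)
    fix x
    assume x: "x \<in> K"
    have "x - scale (f x / f w) w \<in> N"
      using x w K \<open>f w \<noteq> 0\<close>
      by (simp add: N_def diff hom subspace_diff[OF K(1)] subspace_scale[OF K(1)])
    from wN[OF this] have "ip x w = f x / f w * ip w w"
      by (simp add: ip_diff_left ip_scale_left)
    then show "f x = ip x (scale ?c w)"
      using \<open>f w \<noteq> 0\<close> \<open>w \<noteq> 0\<close> by (simp add: ip_scale_right)
  qed
qed

section \<open>Linear maps of a subspace into itself\<close>

text \<open>
  Isomorphisms are only constrained on the subspace \<open>K\<close>, so linearity is relative to \<open>K\<close> as well.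
\<close>
definition linear_into :: "'h set \<Rightarrow> ('h \<Rightarrow> 'h) \<Rightarrow> bool" where
  "linear_into K A \<longleftrightarrow>
    (\<forall>x\<in>K. A x \<in> K) \<and>
    (\<forall>x\<in>K. \<forall>y\<in>K. A (x + y) = A x + A y) \<and>
    (\<forall>c. \<forall>x\<in>K. A (scale c x) = scale c (A x))"

context
  fixes K A
  assumes K: "subspace K" and A: "linear_into K A"
begin

lemma linear_into_mem: "x \<in> K \<Longrightarrow> A x \<in> K"
  and linear_into_add: "x \<in> K \<Longrightarrow> y \<in> K \<Longrightarrow> A (x + y) = A x + A y"
  and linear_into_scale: "x \<in> K \<Longrightarrow> A (scale c x) = scale c (A x)"
  using A by (auto simp: linear_into_def)

lemma linear_into_scaleR: "x \<in> K \<Longrightarrow> A (r *\<^sub>R x) = r *\<^sub>R A x"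
  by (metis linear_into_scale scale_of_real)

lemma linear_into_0: "A 0 = 0"
  using linear_into_scaleR[of 0 0] subspace_0[OF K] by simp

lemma linear_into_diff: "x \<in> K \<Longrightarrow> y \<in> K \<Longrightarrow> A (x - y) = A x - A y"
  using linear_into_add[of "x - y" y] K by (simp add: subspace_diff)

lemma continuous_on_if_bounded:
  assumes "\<And>x. x \<in> K \<Longrightarrow> norm (A x) \<le> \<beta> * norm x"
  shows "continuous_on K A"
proof (rule continuous_onI)
  fix x and \<epsilon> :: real
  assume x: "x \<in> K" and \<epsilon>: "0 < \<epsilon>"
  show "\<exists>d>0. \<forall>x'\<in>K. dist x' x < d \<longrightarrow> dist (A x') (A x) \<le> \<epsilon>"
  proof (intro exI conjI ballI impI)
    show "0 < \<epsilon> / (\<bar>\<beta>\<bar> + 1)" using \<epsilon> by simp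
    fix x'
    assume x': "x' \<in> K" "dist x' x < \<epsilon> / (\<bar>\<beta>\<bar> + 1)"
    have "norm (A x' - A x) \<le> \<beta> * norm (x' - x)"
      using assms[of "x' - x"] x x' K by (simp add: linear_into_diff subspace_diff)
    also have "\<dots> \<le> (\<bar>\<beta>\<bar> + 1) * norm (x' - x)"
      by (intro mult_right_mono) auto
    also have "\<dots> \<le> \<epsilon>" using x'(2) by (simp add: dist_norm field_simps)
    finally show "dist (A x') (A x) \<le> \<epsilon>" by (simp add: dist_norm)
  qed
qed

lemma bounded_if_continuous_on:
  assumes "continuous_on K A"
  obtains \<beta> where "0 < \<beta>" "\<And>x. x \<in> K \<Longrightarrow> norm (A x) \<le> \<beta> * norm x"
proof -
  obtain d where d: "0 < d" "\<And>x. x \<in> K \<Longrightarrow> norm x < d \<Longrightarrow> norm (A x) < 1"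
    using assms[unfolded continuous_on_iff, rule_format, OF subspace_0[OF K], of 1]
    by (auto simp: linear_into_0)
  have "norm (A x) \<le> (2 / d) * norm x" if x: "x \<in> K" for x
  proof (cases "x = 0")
    case False
    let ?r = "d / 2 / norm x"
    have "norm (A (?r *\<^sub>R x)) < 1"
      using d(1) False by (intro d(2) subspace_scaleR[OF K x]) simp
    then have "?r * norm (A x) < 1"
      using d(1) by (simp add: linear_into_scaleR[OF x])
    then show ?thesis using False d(1) by (simp add: field_simps)
  qed (simp add: linear_into_0)
  then show thesis using that[of "2 / d"] d(1) by simp
qed

end

lemma isomorphism_on_linear_into: "isomorphism_on K A \<Longrightarrow> linear_into K A"
  by (auto simp: isomorphism_on_def linear_into_def bij_betw_def)

lemma isomorphism_on_inv_into:
  assumes K: "subspace K" and A: "isomorphism_on K A"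
  shows "isomorphism_on K (inv_into K A)"
proof -
  have bij: "bij_betw A K K" using A by (simp add: isomorphism_on_def)
  have inv: "inv_into K A x \<in> K" "A (inv_into K A x) = x" if "x \<in> K" for x
    using bij that by (auto simp: bij_betw_def inv_into_into f_inv_into_f)
  have inv_eqI: "inv_into K A y = x" if "x \<in> K" "A x = y" for x y
    using bij that by (auto simp: bij_betw_def)
  have "continuous_on K (inv_into K (inv_into K A))"
  proof (subst continuous_on_cong[OF refl])
    show "inv_into K (inv_into K A) x = A x" if "x \<in> K" for x
      using inv_into_inv_into_eq[OF bij that] .
    show "continuous_on K A" using A by (simp add: isomorphism_on_def)
  qed
  moreover have "inv_into K A (x + y) = inv_into K A x + inv_into K A y"
    if "x \<in> K" "y \<in> K" for x y
    using that inv K A by (intro inv_eqI) (auto simp: isomorphism_on_def subspace_add)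
  moreover have "inv_into K A (scale c x) = scale c (inv_into K A x)" if "x \<in> K" for c x
    using that inv K A by (intro inv_eqI) (auto simp: isomorphism_on_def subspace_scale)
  ultimately show ?thesis
    using A bij_betw_inv_into[OF bij] by (simp add: isomorphism_on_def)
qed

lemma isomorphism_onI:
  assumes K: "subspace K" and B: "linear_into K B" and onto: "K \<subseteq> B ` K"
    and upper: "\<And>x. x \<in> K \<Longrightarrow> norm (B x) \<le> \<beta> * norm x"
    and lower: "\<And>x. x \<in> K \<Longrightarrow> norm x \<le> \<gamma> * norm (B x)"
  shows "isomorphism_on K B"
proof -
  have "inj_on B K"
  proof (rule inj_onI)
    fix x y
    assume "x \<in> K" "y \<in> K" "B x = B y"
    then have "norm (x - y) \<le> 0"
      using lower[of "x - y"] by (simp add: linear_into_diff[OF K B] subspace_diff[OF K])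
    then show "x = y" by simp
  qed
  with onto have bij: "bij_betw B K K"
    using linear_into_mem[OF K B] by (auto simp: bij_betw_def)
  have inv: "inv_into K B x \<in> K" "B (inv_into K B x) = x" if "x \<in> K" for x
    using bij that by (auto simp: bij_betw_def inv_into_into f_inv_into_f)
  have inv_eqI: "inv_into K B y = x" if "x \<in> K" "B x = y" for x y
    using bij that by (auto simp: bij_betw_def)
  have "linear_into K (inv_into K B)"
    unfolding linear_into_def
  proof (intro conjI ballI allI)
    show "inv_into K B (x + y) = inv_into K B x + inv_into K B y" if "x \<in> K" "y \<in> K" for x y
      using that inv by (intro inv_eqI) (simp_all add: linear_into_add[OF K B] subspace_add[OF K])
    show "inv_into K B (scale c x) = scale c (inv_into K B x)" if "x \<in> K" for c x
      using that inv
      by (intro inv_eqI) (simp_all add: linear_into_scale[OF K B] subspace_scale[OF K])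
  qed (rule inv(1))
  moreover have "norm (inv_into K B x) \<le> \<gamma> * norm x" if "x \<in> K" for x
    using lower[of "inv_into K B x"] inv[OF that] by simp
  ultimately have "continuous_on K (inv_into K B)"
    using continuous_on_if_bounded[OF K] by blast
  moreover have "continuous_on K B"
    using continuous_on_if_bounded[OF K B] upper by blast
  ultimately show ?thesis
    using B bij by (auto simp: isomorphism_on_def linear_into_def)
qed

lemma linear_into_image_span:
  assumes K: "subspace K" and A: "linear_into K A" and V: "V \<subseteq> K"
  shows "A ` span V \<subseteq> span (A ` V)"
proof safe
  fix x
  assume "x \<in> span V"
  then have "x \<in> K \<and> A x \<in> span (A ` V)"
  proof (induction rule: span_induct_alt)
    case base
    then show ?case
      by (simp add: linear_into_0[OF K A] subspace_0[OF K] span_zero)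
  next
    case (step c x y)
    then have "x \<in> K" "A x \<in> span (A ` V)" using V by (auto intro: span_base)
    with step show ?case
      by (simp add: linear_into_add[OF K A] linear_into_scale[OF K A] subspace_add[OF K]
          subspace_scale[OF K] span_add span_scale)
  qed
  then show "A x \<in> span (A ` V)" by simp
qed

lemma linear_into_image_closed_span:
  assumes K: "subspace K" "closed K" and A: "linear_into K A" "continuous_on K A" and V: "V \<subseteq> K"
  shows "A ` closure (span V) \<subseteq> closure (span (A ` V))"
proof (rule image_closure_subset)
  show "continuous_on (closure (span V)) A"
    using A(2) closed_span_minimal[OF K V] by (rule continuous_on_subset)
  show "A ` span V \<subseteq> closure (span (A ` V))"
    using linear_into_image_span[OF K(1) A(1) V] closure_subset by blast
qed simp

section \<open>Riesz families as orthonormal families for an equivalent norm\<close>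

text \<open>
  The isomorphism \<open>B\<close> is the inverse of the one in the definition of a Riesz basis. Completeness of
  the orthonormal system \<open>B (v \<alpha>)\<close> comes for free: \<open>B\<close> maps the closed span of the \<open>v \<alpha>\<close>, which is
  all of \<open>K\<close>, onto itself and into the closed span of the \<open>B (v \<alpha>)\<close>.
\<close>
lemma riesz_family_iff_orthonormalizing_isomorphism:
  defines "K \<equiv> \<lambda>M v. closure (span (v ` M))"
  shows "riesz_family M v \<longleftrightarrow>
    (\<exists>B. isomorphism_on (K M v) B \<and>
      (\<forall>\<alpha>\<in>M. \<forall>\<beta>\<in>M. ip (B (v \<alpha>)) (B (v \<beta>)) = (if \<alpha> = \<beta> then 1 else 0)))"
proof
  let ?K = "K M v"
  have K: "subspace ?K" "closed ?K" "v ` M \<subseteq> ?K"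
    by (auto simp: K_def subspace_closure intro: in_closed_span)
  {
    assume "riesz_family M v"
    then obtain e A where e: "orthonormal_basis ?K M e" and A: "isomorphism_on ?K A"
      and v: "\<And>\<alpha>. \<alpha> \<in> M \<Longrightarrow> v \<alpha> = A (e \<alpha>)"
      unfolding riesz_family_def riesz_basis_def K_def by blast
    have "inv_into ?K A (v \<alpha>) = e \<alpha>" if "\<alpha> \<in> M" for \<alpha>
      using e A v that
      by (auto simp: orthonormal_basis_def isomorphism_on_def bij_betw_def)
    then show "\<exists>B. isomorphism_on ?K B \<and>
      (\<forall>\<alpha>\<in>M. \<forall>\<beta>\<in>M. ip (B (v \<alpha>)) (B (v \<beta>)) = (if \<alpha> = \<beta> then 1 else 0))"
      using e isomorphism_on_inv_into[OF K(1) A]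
      by (intro exI[of _ "inv_into ?K A"]) (simp add: orthonormal_basis_def)
  next
    assume "\<exists>B. isomorphism_on ?K B \<and>
      (\<forall>\<alpha>\<in>M. \<forall>\<beta>\<in>M. ip (B (v \<alpha>)) (B (v \<beta>)) = (if \<alpha> = \<beta> then 1 else 0))"
    then obtain B where B: "isomorphism_on ?K B"
      and on: "\<forall>\<alpha>\<in>M. \<forall>\<beta>\<in>M. ip (B (v \<alpha>)) (B (v \<beta>)) = (if \<alpha> = \<beta> then 1 else 0)"
      by blast
    have lin: "linear_into ?K B" by (rule isomorphism_on_linear_into[OF B])
    have bij: "bij_betw B ?K ?K" and cont: "continuous_on ?K B"
      using B by (simp_all add: isomorphism_on_def)
    define e where "e = (\<lambda>\<alpha>. B (v \<alpha>))"
    have e: "e \<alpha> \<in> ?K" if "\<alpha> \<in> M" for \<alpha>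
      using linear_into_mem[OF K(1) lin] K(3) that by (auto simp: e_def)
    have "closure (span (e ` M)) \<subseteq> ?K"
      using e K by (intro closed_span_minimal) auto
    moreover have "?K \<subseteq> closure (span (e ` M))"
    proof -
      have "?K = B ` ?K" using bij by (simp add: bij_betw_def)
      also have "B ` ?K \<subseteq> closure (span (B ` v ` M))"
        using linear_into_image_closed_span[OF K(1,2) lin cont K(3)] by (simp add: K_def)
      also have "B ` v ` M = e ` M" by (simp add: e_def image_image)
      finally show ?thesis .
    qed
    ultimately have "orthonormal_basis ?K M e"
      using e on by (auto simp: orthonormal_basis_def e_def)
    moreover have "v \<alpha> = inv_into ?K B (e \<alpha>)" if "\<alpha> \<in> M" for \<alpha>
      using bij K(3) that by (auto simp: e_def bij_betw_def)
    ultimately show "riesz_family M v"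
      using isomorphism_on_inv_into[OF K(1) B]
      unfolding riesz_family_def riesz_basis_def K_def by blast
  }
qed

text \<open>
  If \<open>2 Y = T + Y\<^sup>2\<close> then \<open>(1 - Y)\<^sup>2 = 1 - T\<close>, so this produces a self-adjoint square root of an operator
  at distance less than \<open>1\<close> from the identity. On the operators of norm at most \<open>q\<close> the map
  \<open>Y \<mapsto> (T + Y\<^sup>2) / 2\<close> is a contraction with factor \<open>q\<close>, since
  \<open>Y\<^sup>2 - Z\<^sup>2 = Y (Y - Z) + (Y - Z) Z\<close>. The iteration from \<open>0\<close> is carried out pointwise, where the
  geometric rate makes it converge.
\<close>
lemma fixed_point_root:
  assumes K: "subspace K" "closed K"
    and T: "linear_into K T" "\<And>x y. x \<in> K \<Longrightarrow> y \<in> K \<Longrightarrow> ip (T x) y = ip x (T y)"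
    and q: "\<And>x. x \<in> K \<Longrightarrow> norm (T x) \<le> q * norm x" "0 \<le> q" "q < 1"
  obtains Y where "linear_into K Y" "\<And>x y. x \<in> K \<Longrightarrow> y \<in> K \<Longrightarrow> ip (Y x) y = ip x (Y y)"
    "\<And>x. x \<in> K \<Longrightarrow> norm (Y x) \<le> q * norm x"
    "\<And>x. x \<in> K \<Longrightarrow> 2 *\<^sub>R Y x = T x + Y (Y x)"
proof -
  define Y where "Y = rec_nat (\<lambda>x. 0) (\<lambda>_ Z x. (1/2) *\<^sub>R (T x + Z (Z x)))"
  have Y0: "Y 0 x = 0" and YS: "Y (Suc n) x = (1/2) *\<^sub>R (T x + Y n (Y n x))" for n x
    by (simp_all add: Y_def)
  have lin: "linear_into K (Y n)" for n
  proof (induction n)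
    case 0
    then show ?case by (simp add: linear_into_def Y0 subspace_0[OF K(1)])
  next
    case (Suc n)
    note Z = linear_into_mem[OF K(1) Suc] linear_into_add[OF K(1) Suc] linear_into_scale[OF K(1) Suc]
      linear_into_mem[OF K(1) T(1)] linear_into_add[OF K(1) T(1)] linear_into_scale[OF K(1) T(1)]
    show ?case
      unfolding linear_into_def
    proof (intro conjI ballI allI)
      show "Y (Suc n) x \<in> K" if "x \<in> K" for x
        unfolding YS by (intro subspace_scaleR[OF K(1)] subspace_add[OF K(1)] Z that)
      show "Y (Suc n) (x + y) = Y (Suc n) x + Y (Suc n) y" if "x \<in> K" "y \<in> K" for x y
        using that by (simp add: YS Z scaleR_right_distrib)
      show "Y (Suc n) (scale c x) = scale c (Y (Suc n) x)" if "x \<in> K" for c x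
        using that by (simp add: YS Z scale_right_distrib scaleR_right_distrib flip: scaleR_scale_commute)
    qed
  qed
  note mem = linear_into_mem[OF K(1) lin]
  have sym: "x \<in> K \<Longrightarrow> y \<in> K \<Longrightarrow> ip (Y n x) y = ip x (Y n y)" for n x y
  proof (induction n arbitrary: x y)
    case (Suc n)
    have "ip (Y n (Y n x)) y = ip x (Y n (Y n y))"
      using Suc mem by metis
    with T(2)[OF Suc.prems] show ?case
      by (simp add: YS ip_scaleR_left ip_scaleR_right ip_add_left ip_add_right)
  qed (simp add: Y0)
  have bound: "x \<in> K \<Longrightarrow> norm (Y n x) \<le> q * norm x" for n x
  proof (induction n arbitrary: x)
    case (Suc n)
    have "norm (Y n (Y n x)) \<le> q * norm (Y n x)" using Suc mem by blast
    also have "\<dots> \<le> 1 * norm (Y n x)" using q by (intro mult_right_mono) auto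
    also have "\<dots> \<le> q * norm x" using Suc by simp
    finally have "norm (T x + Y n (Y n x)) \<le> 2 * (q * norm x)"
      using q(1)[OF Suc.prems] norm_triangle_ineq[of "T x" "Y n (Y n x)"] by linarith
    then show ?case by (simp add: YS)
  qed (simp add: Y0 q(2))
  have step: "x \<in> K \<Longrightarrow> norm (Y (Suc n) x - Y n x) \<le> norm x * q ^ n" for n x
  proof (induction n arbitrary: x)
    case 0
    have "norm (T x) \<le> 1 * norm x"
      using q(1)[OF 0] q(3) mult_right_mono[of q 1 "norm x"] by simp
    moreover have "0 \<le> norm x" by simp
    ultimately have "norm (T x) \<le> 2 * norm x" by linarith
    then show ?case by (simp add: YS Y0)
  next
    case (Suc n)
    let ?y = "Y (Suc n) x"
    have y: "?y \<in> K" "Y n x \<in> K" using mem Suc.prems by auto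
    have "norm (Y n ?y - Y n (Y n x)) = norm (Y n (?y - Y n x))"
      by (simp add: linear_into_diff[OF K(1) lin] y)
    also have "\<dots> \<le> q * norm (?y - Y n x)" using y K by (intro bound subspace_diff)
    also have "\<dots> \<le> q * (norm x * q ^ n)" using Suc q(2) by (intro mult_left_mono)
    finally have 1: "norm (Y n ?y - Y n (Y n x)) \<le> norm x * q ^ Suc n" by (simp add: ac_simps)
    have "norm (Y (Suc n) ?y - Y n ?y) \<le> norm ?y * q ^ n" using Suc.IH[OF y(1)] .
    also have "\<dots> \<le> (q * norm x) * q ^ n"
      using bound[OF Suc.prems] q(2) by (intro mult_right_mono) auto
    finally have 2: "norm (Y (Suc n) ?y - Y n ?y) \<le> norm x * q ^ Suc n" by (simp add: ac_simps)
    have "Y (Suc (Suc n)) x - ?y = (1/2) *\<^sub>R ((Y (Suc n) ?y - Y n ?y) + (Y n ?y - Y n (Y n x)))"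
      by (subst (1 2) YS) (simp add: algebra_simps)
    also have "norm \<dots> \<le> (1/2) * (norm x * q ^ Suc n + norm x * q ^ Suc n)"
      using norm_triangle_mono[OF 2 1] by simp
    finally show ?case by (simp add: mult.left_commute)
  qed
  have "\<exists>l. (\<lambda>n. Y n x) \<longlonglongrightarrow> l" if "x \<in> K" for x
    using geometric_steps_converge[of q "\<lambda>n. Y n x" "norm x"] q step[OF that] by metis
  then obtain Z where Z: "\<And>x. x \<in> K \<Longrightarrow> (\<lambda>n. Y n x) \<longlonglongrightarrow> Z x" by metis
  have ZK: "Z x \<in> K" if "x \<in> K" for x
    using closed_sequentially[OF K(2) _ Z[OF that]] mem[OF that] by blast
  show thesis
  proof (rule that)
    show "linear_into K Z"
      unfolding linear_into_def
    proof (intro conjI ballI allI)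
      fix x y
      assume "x \<in> K" "y \<in> K"
      then show "Z (x + y) = Z x + Z y"
        using Z[of "x + y"] tendsto_add[OF Z[of x] Z[of y]] K
        by (simp add: linear_into_add[OF K(1) lin] subspace_add LIMSEQ_unique)
    next
      fix c x
      assume "x \<in> K"
      then show "Z (scale c x) = scale c (Z x)"
        using Z[of "scale c x"] tendsto_scale[OF Z[of x]] K
        by (simp add: linear_into_scale[OF K(1) lin] subspace_scale LIMSEQ_unique)
    qed (rule ZK)
    fix x
    assume x: "x \<in> K"
    show ip: "ip (Z x) y = ip x (Z y)" if "y \<in> K" for y
      using tendsto_ip_left[OF Z[OF x], of y] tendsto_ip_right[OF Z[OF that], of x]
      by (simp add: sym x that LIMSEQ_unique)
    show "norm (Z x) \<le> q * norm x"
      using tendsto_norm[OF Z[OF x]] bound[OF x] by (intro LIMSEQ_le_const2) auto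
    have "(\<lambda>n. Y n (Y n x)) \<longlonglongrightarrow> Z (Z x)"
    proof (rule LIM_zero_cancel, rule tendsto_0_le)
      show "(\<lambda>n. norm (Y n x - Z x) + norm (Y n (Z x) - Z (Z x))) \<longlonglongrightarrow> 0"
        using Z[OF x] Z[OF ZK[OF x]] by (auto intro!: tendsto_add_zero tendsto_norm_zero LIM_zero)
      have "norm (Y n (Y n x) - Z (Z x)) \<le> norm (Y n x - Z x) + norm (Y n (Z x) - Z (Z x))" for n
      proof -
        have "norm (Y n (Y n x) - Y n (Z x)) = norm (Y n (Y n x - Z x))"
          by (simp add: linear_into_diff[OF K(1) lin] mem ZK x)
        also have "\<dots> \<le> q * norm (Y n x - Z x)"
          using mem ZK x K by (intro bound subspace_diff)
        also have "\<dots> \<le> 1 * norm (Y n x - Z x)" using q by (intro mult_right_mono) auto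
        finally show ?thesis
          using norm_triangle_ineq[of "Y n (Y n x) - Y n (Z x)" "Y n (Z x) - Z (Z x)"] by simp
      qed
      then show "\<forall>\<^sub>F n in sequentially. norm (Y n (Y n x) - Z (Z x))
          \<le> norm (norm (Y n x - Z x) + norm (Y n (Z x) - Z (Z x))) * 1"
        by (simp add: abs_of_nonneg)
    qed
    then have "(\<lambda>n. Y (Suc n) x) \<longlonglongrightarrow> (1/2) *\<^sub>R (T x + Z (Z x))"
      unfolding YS by (intro tendsto_intros)
    then have "Z x = (1/2) *\<^sub>R (T x + Z (Z x))"
      using LIMSEQ_Suc[OF Z[OF x]] LIMSEQ_unique by blast
    then show "2 *\<^sub>R Z x = T x + Z (Z x)"
      by (metis scaleR_scaleR scaleR_one mult.commute nonzero_eq_divide_eq zero_neq_numeral)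
  qed
qed

lemma isomorphism_on_bounds:
  assumes K: "subspace K" and B: "isomorphism_on K B"
  obtains \<beta> \<gamma> where "0 < \<beta>" "0 < \<gamma>"
    "\<And>x. x \<in> K \<Longrightarrow> norm (B x) \<le> \<beta> * norm x" "\<And>x. x \<in> K \<Longrightarrow> norm x \<le> \<gamma> * norm (B x)"
proof -
  note inv = isomorphism_on_inv_into[OF K B]
  obtain \<beta> where \<beta>: "0 < \<beta>" "\<And>x. x \<in> K \<Longrightarrow> norm (B x) \<le> \<beta> * norm x"
    using bounded_if_continuous_on[OF K isomorphism_on_linear_into[OF B]] B
    by (auto simp: isomorphism_on_def)
  obtain \<gamma> where \<gamma>: "0 < \<gamma>" "\<And>x. x \<in> K \<Longrightarrow> norm (inv_into K B x) \<le> \<gamma> * norm x"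
    using bounded_if_continuous_on[OF K isomorphism_on_linear_into[OF inv]] B
    by (auto simp: isomorphism_on_def)
  have "norm x \<le> \<gamma> * norm (B x)" if "x \<in> K" for x
  proof -
    have "B x \<in> K" "inv_into K B (B x) = x"
      using B that by (auto simp: isomorphism_on_def bij_betw_def)
    with \<gamma>(2)[of "B x"] show ?thesis by simp
  qed
  with \<beta> \<gamma>(1) show thesis by (intro that[of \<beta> \<gamma>])
qed

text \<open>
  Every Hermitian form on \<open>K\<close> that is equivalent to the inner product is its pullback along an
  isomorphism. The form is \<open>b x y = ip x (G y)\<close> with \<open>G\<close> self-adjoint, bounded and bounded below
  (Riesz representation), and \<open>B\<close> is a self-adjoint square root of \<open>G\<close>: then
  \<open>ip (B x) (B y) = ip x (B (B y)) = b x y\<close>. The root is taken of \<open>t G\<close> for a small \<open>t > 0\<close> that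
  brings \<open>t G\<close> within distance \<open>q < 1\<close> of the identity.
\<close>
lemma renorming:
  assumes K: "subspace K" "closed K"
    and add: "\<And>x y z. x \<in> K \<Longrightarrow> y \<in> K \<Longrightarrow> z \<in> K \<Longrightarrow> b (x + y) z = b x z + b y z"
    and hom: "\<And>a x y. x \<in> K \<Longrightarrow> y \<in> K \<Longrightarrow> b (scale a x) y = a * b x y"
    and herm: "\<And>x y. x \<in> K \<Longrightarrow> y \<in> K \<Longrightarrow> b x y = conjugate (b y x)"
    and bounded: "\<And>x y. x \<in> K \<Longrightarrow> y \<in> K \<Longrightarrow> norm (b x y) \<le> C * norm x * norm y"
    and coercive: "\<And>x. x \<in> K \<Longrightarrow> \<exists>r. b x x = of_real r \<and> c * (norm x)\<^sup>2 \<le> r"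
    and c: "0 < c"
  obtains B where "isomorphism_on K B" "\<And>x y. x \<in> K \<Longrightarrow> y \<in> K \<Longrightarrow> ip (B x) (B y) = b x y"
proof -
  have add_right: "b x (y + z) = b x y + b x z" if "x \<in> K" "y \<in> K" "z \<in> K" for x y z
    using that K by (metis add herm conjugate_add subspace_add)
  have hom_right: "b x (scale a y) = conjugate a * b x y" if "x \<in> K" "y \<in> K" for a x y
    using that K by (metis hom herm conjugate_mult subspace_scale)
  define D where "D = max C c"
  have D: "0 < D" "c \<le> D" using c by (auto simp: D_def)
  have bD: "norm (b x y) \<le> D * norm x * norm y" if "x \<in> K" "y \<in> K" for x y
  proof -
    have "norm (b x y) \<le> C * (norm x * norm y)" using bounded[OF that] by (simp add: ac_simps)
    also have "\<dots> \<le> D * (norm x * norm y)" by (intro mult_right_mono) (auto simp: D_def)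
    finally show ?thesis by (simp add: ac_simps)
  qed
  have "\<exists>z\<in>K. \<forall>x\<in>K. ip x z = b x y" if y: "y \<in> K" for y
  proof (rule riesz_representation[OF K, of "\<lambda>x. b x y" "D * norm y"])
    show "norm (b x y) \<le> D * norm y * norm x" if "x \<in> K" for x
      using bD[OF that y] by (simp add: ac_simps)
  qed (use y add hom in auto)
  then obtain G where GK: "\<And>y. y \<in> K \<Longrightarrow> G y \<in> K"
    and G: "\<And>x y. x \<in> K \<Longrightarrow> y \<in> K \<Longrightarrow> ip x (G y) = b x y" by metis
  have G': "ip (G x) y = b x y" if "x \<in> K" "y \<in> K" for x y
    using that by (metis G herm ip_commute)
  have linG: "linear_into K G"
    unfolding linear_into_def
  proof (intro conjI ballI allI)
    show "G (x + y) = G x + G y" if "x \<in> K" "y \<in> K" for x y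
      using that K
      by (intro ip_eqI[OF K(1)]) (simp_all add: GK G ip_add_right add_right subspace_add)
    show "G (scale a x) = scale a (G x)" if "x \<in> K" for a x
      using that K
      by (intro ip_eqI[OF K(1)]) (simp_all add: GK G ip_scale_right hom_right subspace_scale)
  qed (rule GK)
  have normG: "norm (G x) \<le> D * norm x" if x: "x \<in> K" for x
  proof (cases "G x = 0")
    case False
    have "norm (ip (G x) (G x)) \<le> D * norm (G x) * norm x"
      using bD[OF GK[OF x] x] G[OF GK[OF x] x] by simp
    then have "norm (G x) * norm (G x) \<le> norm (G x) * (D * norm x)"
      by (simp add: ip_self norm_mult power2_eq_square ac_simps)
    then show ?thesis using False by simp
  qed (use D in simp)
  \<comment> \<open>The bound \<open>1 - 2 t c + t\<^sup>2 D\<^sup>2\<close> for the squared norm of \<open>1 - t G\<close> is least at \<open>t = c / D\<^sup>2\<close>,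
    with value \<open>q\<^sup>2 = 1 - (c / D)\<^sup>2\<close>.\<close>
  define t where "t = c / D\<^sup>2"
  have t: "0 < t" using c D by (simp add: t_def)
  define q where "q = sqrt (1 - (c / D)\<^sup>2)"
  have cD: "0 < c / D" "c / D \<le> 1" using c D by auto
  then have "(c / D)\<^sup>2 \<le> 1" by (simp add: power_le_one)
  then have q2: "q\<^sup>2 = 1 - (c / D)\<^sup>2" and q0: "0 \<le> q" by (simp_all add: q_def)
  have q1: "q < 1" using c D by (simp add: q_def)
  define T where "T = (\<lambda>x. x - t *\<^sub>R G x)"
  have linT: "linear_into K T"
    unfolding linear_into_def T_def
    using K GK by (simp add: linear_into_add[OF K(1) linG] linear_into_scale[OF K(1) linG]
        subspace_diff subspace_scaleR scaleR_right_distrib scale_right_diff_distrib scaleR_scale_commute)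
  have symT: "ip (T x) y = ip x (T y)" if "x \<in> K" "y \<in> K" for x y
    using that by (simp add: T_def ip_diff_left ip_diff_right ip_scaleR_left ip_scaleR_right G G')
  have normT: "norm (T x) \<le> q * norm x" if x: "x \<in> K" for x
  proof -
    obtain r where r: "b x x = of_real r" "c * (norm x)\<^sup>2 \<le> r" using coercive[OF x] by blast
    have "ip (T x) (T x) = ip x x - of_real t * b x x - of_real t * b x x
        + of_real t * of_real t * ip (G x) (G x)"
      by (simp add: T_def ip_diff_left ip_diff_right ip_scaleR_left ip_scaleR_right G G' x
          algebra_simps)
    then have "of_real ((norm (T x))\<^sup>2)
        = (of_real ((norm x)\<^sup>2 - t * r - t * r + t * t * (norm (G x))\<^sup>2) :: 'k)"
      by (simp only: r ip_self of_real_diff of_real_add of_real_mult)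
    then have "(norm (T x))\<^sup>2 = (norm x)\<^sup>2 - t * r - t * r + t * t * (norm (G x))\<^sup>2"
      by (simp only: of_real_eq_iff)
    also have "\<dots> \<le> (norm x)\<^sup>2 - t * (c * (norm x)\<^sup>2) - t * (c * (norm x)\<^sup>2)
        + t * t * (D * norm x)\<^sup>2"
    proof -
      have "t * (c * (norm x)\<^sup>2) \<le> t * r" using r t by (intro mult_left_mono) auto
      moreover have "t * t * (norm (G x))\<^sup>2 \<le> t * t * (D * norm x)\<^sup>2"
        using normG[OF x] by (intro mult_left_mono power_mono) auto
      ultimately show ?thesis by linarith
    qed
    also have "\<dots> = q\<^sup>2 * (norm x)\<^sup>2"
      using D unfolding q2 t_def by (simp add: field_simps power2_eq_square)
    finally have "(norm (T x))\<^sup>2 \<le> (q * norm x)\<^sup>2" by (simp add: power_mult_distrib)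
    then show ?thesis by (rule power2_le_imp_le) (simp add: q0)
  qed
  obtain Y where linY: "linear_into K Y"
    and symY: "\<And>x y. x \<in> K \<Longrightarrow> y \<in> K \<Longrightarrow> ip (Y x) y = ip x (Y y)"
    and normY: "\<And>x. x \<in> K \<Longrightarrow> norm (Y x) \<le> q * norm x"
    and Y: "\<And>x. x \<in> K \<Longrightarrow> 2 *\<^sub>R Y x = T x + Y (Y x)"
    using fixed_point_root[OF K linT symT normT q0 q1] by blast
  note YK = linear_into_mem[OF K(1) linY]
  define R where "R = (\<lambda>x. x - Y x)"
  have RK: "R x \<in> K" if "x \<in> K" for x
    using that YK K by (simp add: R_def subspace_diff)
  have RR: "R (R x) = t *\<^sub>R G x" if "x \<in> K" for x
  proof -
    have "R (R x) = x - 2 *\<^sub>R Y x + Y (Y x)"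
      by (simp add: R_def linear_into_diff[OF K(1) linY] that YK scaleR_2)
    then show ?thesis by (simp add: Y[OF that] T_def)
  qed
  have symR: "ip (R x) y = ip x (R y)" if "x \<in> K" "y \<in> K" for x y
    using symY[OF that] by (simp add: R_def ip_diff_left ip_diff_right)
  define B where "B = (\<lambda>x. (1 / sqrt t) *\<^sub>R R x)"
  have "ip (B x) (B y) = b x y" if "x \<in> K" "y \<in> K" for x y
  proof -
    have "ip (B x) (B y) = of_real (1 / sqrt t * (1 / sqrt t)) * ip x (R (R y))"
      using that by (simp only: B_def ip_scaleR_left ip_scaleR_right symR RK of_real_mult mult.assoc)
    also have "\<dots> = of_real (1 / sqrt t * (1 / sqrt t) * t) * b x y"
      using that by (simp only: RR ip_scaleR_right G GK of_real_mult mult.assoc)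
    also have "1 / sqrt t * (1 / sqrt t) * t = 1" using t by simp
    finally show ?thesis by simp
  qed
  moreover have "isomorphism_on K B"
  proof (rule isomorphism_onI[OF K(1)])
    show "linear_into K B"
      unfolding linear_into_def B_def R_def
      using K YK by (simp add: linear_into_add[OF K(1) linY] linear_into_scale[OF K(1) linY]
          subspace_diff subspace_scaleR scaleR_right_distrib scaleR_right_diff_distrib
          scale_right_diff_distrib scaleR_scale_commute)
    show "K \<subseteq> B ` K"
    proof
      fix z
      assume z: "z \<in> K"
      \<comment> \<open>Solving \<open>B u = z\<close> means \<open>u - Y u = sqrt t *\<^sub>R z\<close>, a fixed point equation for a contraction.\<close>
      have "\<exists>!u\<in>K. sqrt t *\<^sub>R z + Y u = u"
      proof (rule Banach_fix)
        show "complete K" using K(2) by (simp add: complete_eq_closed)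
        show "K \<noteq> {}" using z by blast
        show "(\<lambda>u. sqrt t *\<^sub>R z + Y u) ` K \<subseteq> K"
          using z YK K by (auto intro!: subspace_add subspace_scaleR)
        show "dist (sqrt t *\<^sub>R z + Y x) (sqrt t *\<^sub>R z + Y y) \<le> q * dist x y"
          if "x \<in> K" "y \<in> K" for x y
          using normY[of "x - y"] that
          by (simp add: dist_norm linear_into_diff[OF K(1) linY] subspace_diff[OF K(1)])
      qed (use q0 q1 in auto)
      then obtain u where u: "u \<in> K" "sqrt t *\<^sub>R z + Y u = u" by blast
      then have "R u = sqrt t *\<^sub>R z" by (simp add: R_def algebra_simps)
      then have "B u = z" using t by (simp add: B_def)
      with u show "z \<in> B ` K" by blast
    qed
    fix x
    assume x: "x \<in> K"
    have "norm (R x) \<le> norm x + norm (Y x)" unfolding R_def by (rule norm_triangle_ineq4)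
    also have "\<dots> \<le> (1 + q) * norm x" using normY[OF x] by (simp add: algebra_simps)
    finally show "norm (B x) \<le> ((1 + q) / sqrt t) * norm x"
      using t by (simp add: B_def divide_right_mono)
    have "norm x - norm (Y x) \<le> norm (R x)" unfolding R_def by (rule norm_triangle_ineq2)
    then have "(1 - q) * norm x \<le> norm (R x)" using normY[OF x] by (simp add: algebra_simps)
    then have "norm x \<le> norm (R x) / (1 - q)"
      using q1 by (simp add: pos_le_divide_eq mult.commute)
    then show "norm x \<le> (sqrt t / (1 - q)) * norm (B x)"
      using t by (simp add: B_def)
  qed
  ultimately show thesis using that by blast
qed

section \<open>From the IBAP to bounded components\<close>

text \<open>
  The uniform boundedness principle, with weights \<open>w i\<close> so that it applies directly to homogeneous
  estimates. The proof is a gliding hump: if the claim fails, choose \<open>a n\<close> with norm above \<open>4\<^sup>n\<close> times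
  its weight and build \<open>z\<close> by steps \<open>h n\<close> of length \<open>3\<^sup>-\<^sup>n\<close> along \<open>\<plusminus> a n\<close>, with the sign that makes
  \<open>ip (a n) (z (Suc n))\<close> large. The later steps have total length at most \<open>3\<^sup>-\<^sup>n / 2\<close> and destroy at
  most half of it, so the limit violates the pointwise bound.
\<close>
lemma weakly_bounded_imp_bounded:
  assumes S: "subspace S" "closed S"
    and b: "\<And>i. i \<in> I \<Longrightarrow> b i \<in> S" and w: "\<And>i. i \<in> I \<Longrightarrow> 0 \<le> w i"
    and weak: "\<And>z. z \<in> S \<Longrightarrow> \<exists>m. \<forall>i\<in>I. norm (ip (b i) z) \<le> m * w i"
  shows "\<exists>C. \<forall>i\<in>I. norm (b i) \<le> C * w i"
proof (rule ccontr)
  assume "\<nexists>C. \<forall>i\<in>I. norm (b i) \<le> C * w i"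
  then have "\<exists>i\<in>I. 4 ^ n * w i < norm (b i)" for n :: nat
    by (meson not_le)
  then obtain j where j: "\<And>n. j n \<in> I" "\<And>n. 4 ^ n * w (j n) < norm (b (j n))"
    by metis
  define a where "a = (\<lambda>n. b (j n))"
  have aS: "a n \<in> S" for n using b j by (simp add: a_def)
  have a_pos: "0 < norm (a n)" for n
    using w[OF j(1)[of n]] j(2)[of n] by (smt (verit) a_def mult_nonneg_nonneg zero_le_power)
  define h where "h = (\<lambda>n. ((1/3) ^ n / norm (a n)) *\<^sub>R a n)"
  have hS: "h n \<in> S" for n using aS S by (simp add: h_def subspace_scaleR)
  have norm_h: "norm (h n) = (1/3) ^ n" for n using a_pos[of n] by (simp add: h_def)
  have ip_h: "norm (ip (a n) (h n)) = (1/3) ^ n * norm (a n)" for n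
    using a_pos[of n]
    by (simp add: h_def ip_scaleR_right ip_self norm_mult norm_power norm_divide power2_eq_square)
  define z where "z = rec_nat 0 (\<lambda>n x.
    if (1/3) ^ n * norm (a n) \<le> norm (ip (a n) (x + h n)) then x + h n else x - h n)"
  have z0: "z 0 = 0"
    and zS: "z (Suc n) = (if (1/3) ^ n * norm (a n) \<le> norm (ip (a n) (z n + h n))
      then z n + h n else z n - h n)" for n
    by (simp_all add: z_def)
  have mem: "z n \<in> S" for n
    by (induction n) (auto simp: z0 zS hS subspace_0[OF S(1)] subspace_add[OF S(1)] subspace_diff[OF S(1)])
  have large: "(1/3) ^ n * norm (a n) \<le> norm (ip (a n) (z (Suc n)))" for n
  proof (rule ccontr)
    assume *: "\<not> ?thesis"
    then have 1: "norm (ip (a n) (z n + h n)) < (1/3) ^ n * norm (a n)"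
      by (auto simp: zS split: if_splits)
    with * have 2: "norm (ip (a n) (z n - h n)) < (1/3) ^ n * norm (a n)"
      by (auto simp: zS split: if_splits)
    have "ip (a n) (z n + h n) - ip (a n) (z n - h n) = 2 * ip (a n) (h n)"
      by (simp add: ip_add_right ip_diff_right)
    then have "2 * norm (ip (a n) (h n)) = norm (ip (a n) (z n + h n) - ip (a n) (z n - h n))"
      by (simp add: norm_mult)
    also have "\<dots> \<le> norm (ip (a n) (z n + h n)) + norm (ip (a n) (z n - h n))"
      by (rule norm_triangle_ineq4)
    finally show False using 1 2 ip_h[of n] by linarith
  qed
  have "norm (z (Suc n) - z n) \<le> 1 * (1/3) ^ n" for n
    by (simp add: zS norm_h)
  then obtain l where l: "z \<longlonglongrightarrow> l"
    and tail: "\<And>n. norm (l - z n) \<le> 1 * (1/3) ^ n / (1 - 1/3)"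
    by (rule geometric_steps_converge[of "1/3" z 1, rotated 2]) auto
  have "l \<in> S" using closed_sequentially[OF S(2) _ l] mem by blast
  then obtain m where m: "\<And>i. i \<in> I \<Longrightarrow> norm (ip (b i) l) \<le> m * w i"
    using weak by blast
  have "(4/3) ^ n < 2 * m" for n
  proof -
    have "norm (ip (a n) (z (Suc n) - l)) \<le> norm (a n) * norm (z (Suc n) - l)"
      by (rule cauchy_schwarz)
    also have "\<dots> \<le> norm (a n) * ((1/3) ^ n / 2)"
      using tail[of "Suc n"] by (intro mult_left_mono) (simp_all add: norm_minus_commute)
    finally have "norm (ip (a n) (z (Suc n)) - ip (a n) l) \<le> norm (a n) * ((1/3) ^ n / 2)"
      by (simp add: ip_diff_right)
    then have "(1/3) ^ n * norm (a n) / 2 \<le> norm (ip (a n) l)"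
      using large[of n] norm_triangle_ineq2[of "ip (a n) (z (Suc n))" "ip (a n) l"]
      by (simp only: mult.commute[of "norm (a n)"])
    also have "\<dots> \<le> m * w (j n)" using m[OF j(1)] by (simp add: a_def)
    finally have upper: "norm (a n) \<le> 2 * m * 3 ^ n * w (j n)"
      by (simp add: power_one_over field_simps)
    then have "w (j n) \<noteq> 0" using a_pos[of n] by auto
    then have wpos: "0 < w (j n)" using w[OF j(1)[of n]] by simp
    have "4 ^ n * w (j n) < 2 * m * 3 ^ n * w (j n)"
      using upper j(2)[of n] by (simp add: a_def)
    then have "4 ^ n < 2 * m * 3 ^ n" using wpos by simp
    then show ?thesis by (simp add: power_divide field_simps)
  qed
  moreover obtain n where "2 * m < (4/3) ^ n"
    using real_arch_pow[of "4/3" "2 * m"] by auto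
  ultimately show False by (meson less_asym)
qed

text \<open>
  By the IBAP every \<open>z\<close> in \<open>H k\<close> is the projection to \<open>H k\<close> of some \<open>y\<close> whose other projections
  vanish. Testing against \<open>y\<close> reads off a component of a sum:
  \<open>ip (f k) z = ip (sum f {1..n}) y\<close>. So the \<open>k\<close>-th components are bounded by the sums when tested
  against a fixed \<open>z\<close>, and hence uniformly.
\<close>
lemma IBAP_imp_components_bounded:
  assumes ibap: "IBAP n H" and H: "\<And>i. i \<in> {1..n} \<Longrightarrow> subspace (H i)" "\<And>i. i \<in> {1..n} \<Longrightarrow> closed (H i)"
  obtains C where "\<And>f k. f \<in> Pi {1..n} H \<Longrightarrow> k \<in> {1..n} \<Longrightarrow> norm (f k) \<le> C * norm (sum f {1..n})"
proof -
  have "\<exists>C. \<forall>f\<in>Pi {1..n} H. norm (f k) \<le> C * norm (sum f {1..n})" if k: "k \<in> {1..n}" for k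
  proof (rule weakly_bounded_imp_bounded[OF H(1,2)[OF k]])
    fix z
    assume z: "z \<in> H k"
    let ?x = "\<lambda>i. if i = k then z else 0"
    have "\<forall>i\<in>{1..n}. ?x i \<in> H i" using z H(1) subspace_0 by auto
    then obtain y where y: "\<And>i. i \<in> {1..n} \<Longrightarrow> orth_proj (H i) y = ?x i"
      using ibap[unfolded IBAP_def, THEN spec, of ?x] by blast
    have "norm (ip (f k) z) \<le> norm y * norm (sum f {1..n})" if f: "f \<in> Pi {1..n} H" for f
    proof -
      have "ip (f k) z = (\<Sum>i\<in>{1..n}. if i = k then ip (f i) z else 0)"
        using k by (simp add: sum.delta)
      also have "\<dots> = (\<Sum>i\<in>{1..n}. ip (f i) y)"
      proof (rule sum.cong[OF refl])
        fix i
        assume i: "i \<in> {1..n}"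
        have "ip (f i) y = ip (f i) (?x i)"
          using ip_orth_proj[OF H(1,2)[OF i], of "f i" y] f y[OF i] i by (auto simp: Pi_iff)
        then show "(if i = k then ip (f i) z else 0) = ip (f i) y" by simp
      qed
      finally show ?thesis
        using cauchy_schwarz[of "sum f {1..n}" y] by (simp add: ip_sum_left mult.commute)
    qed
    then show "\<exists>m. \<forall>f\<in>Pi {1..n} H. norm (ip (f k) z) \<le> m * norm (sum f {1..n})" by blast
  qed (use k in auto)
  then obtain C where C: "\<And>f k. f \<in> Pi {1..n} H \<Longrightarrow> k \<in> {1..n} \<Longrightarrow>
      norm (f k) \<le> C k * norm (sum f {1..n})" by metis
  show thesis
  proof (rule that)
    fix f k
    assume fk: "f \<in> Pi {1..n} H" "k \<in> {1..n}"
    have "C k \<le> \<bar>C k\<bar>" by simp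
    also have "\<dots> \<le> (\<Sum>i\<in>{1..n}. \<bar>C i\<bar>)" using fk(2) by (intro member_le_sum) auto
    finally have "C k * norm (sum f {1..n}) \<le> (\<Sum>i\<in>{1..n}. \<bar>C i\<bar>) * norm (sum f {1..n})"
      by (intro mult_right_mono) auto
    with C[OF fk] show "norm (f k) \<le> (\<Sum>i\<in>{1..n}. \<bar>C i\<bar>) * norm (sum f {1..n})" by simp
  qed
qed

section \<open>Combining Riesz families\<close>

text \<open>
  The components of a convergent sequence of sums are Cauchy, because each component is controlled
  by the sum.
\<close>
lemma closed_sum_of_bounded_components:
  assumes K: "\<And>i. i \<in> I \<Longrightarrow> subspace (K i)" "\<And>i. i \<in> I \<Longrightarrow> closed (K i)"
    and C: "\<And>f i. f \<in> Pi I K \<Longrightarrow> i \<in> I \<Longrightarrow> norm (f i) \<le> C * norm (sum f I)"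
  shows "closed ((\<lambda>f. sum f I) ` Pi I K)"
  unfolding closed_sequential_limits
proof (intro allI impI)
  fix s l
  assume s: "(\<forall>n. s n \<in> (\<lambda>f. sum f I) ` Pi I K) \<and> s \<longlonglongrightarrow> l"
  then have l: "s \<longlonglongrightarrow> l" by blast
  have "\<forall>n. \<exists>f. f \<in> Pi I K \<and> s n = sum f I" using s by blast
  then obtain f where f: "\<And>n. f n \<in> Pi I K" "\<And>n. s n = sum (f n) I" by metis
  have "\<exists>g. g \<in> K i \<and> (\<lambda>n. f n i) \<longlonglongrightarrow> g" if i: "i \<in> I" for i
  proof -
    have diff: "norm (f m i - f n i) \<le> (\<bar>C\<bar> + 1) * norm (s m - s n)" for m n
    proof -
      have "(\<lambda>i. f m i - f n i) \<in> Pi I K" using f(1) K(1) by (auto simp: Pi_iff subspace_diff)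
      from C[OF this i] have "norm (f m i - f n i) \<le> C * norm (s m - s n)"
        by (simp add: f(2) sum_subtractf)
      also have "\<dots> \<le> (\<bar>C\<bar> + 1) * norm (s m - s n)" by (intro mult_right_mono) auto
      finally show ?thesis .
    qed
    have "Cauchy (\<lambda>n. f n i)"
    proof (rule CauchyI)
      fix e :: real
      assume e: "0 < e"
      then have "0 < e / (\<bar>C\<bar> + 1)" by simp
      then obtain N where N: "\<And>m n. m \<ge> N \<Longrightarrow> n \<ge> N \<Longrightarrow> norm (s m - s n) < e / (\<bar>C\<bar> + 1)"
        using CauchyD[OF LIMSEQ_imp_Cauchy[OF l]] by blast
      have "norm (f m i - f n i) < e" if "m \<ge> N" "n \<ge> N" for m n
        using diff[of m n] N[OF that] by (simp add: field_simps)
      then show "\<exists>N. \<forall>m\<ge>N. \<forall>n\<ge>N. norm (f m i - f n i) < e" by blast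
    qed
    then obtain g where g: "(\<lambda>n. f n i) \<longlonglongrightarrow> g"
      using Cauchy_convergent convergent_def by blast
    moreover have "g \<in> K i"
      using closed_sequentially[OF K(2)[OF i] _ g] f(1) i by (auto simp: Pi_iff)
    ultimately show ?thesis by blast
  qed
  then obtain g where g: "\<And>i. i \<in> I \<Longrightarrow> g i \<in> K i" "\<And>i. i \<in> I \<Longrightarrow> (\<lambda>n. f n i) \<longlonglongrightarrow> g i"
    by metis
  have "s \<longlonglongrightarrow> sum g I" unfolding f(2) using g(2) by (rule tendsto_sum)
  then have "l = sum g I" using l LIMSEQ_unique by blast
  with g(1) show "l \<in> (\<lambda>f. sum f I) ` Pi I K" by auto
qed

lemma subspace_sums:
  assumes K: "\<And>i. i \<in> I \<Longrightarrow> subspace (K i)"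
  shows "subspace ((\<lambda>f. sum f I) ` Pi I K)"
proof (rule subspaceI)
  show "0 \<in> (\<lambda>f. sum f I) ` Pi I K"
    using K by (intro image_eqI[of _ _ "\<lambda>_. 0"]) (auto simp: subspace_0)
next
  fix x y
  assume "x \<in> (\<lambda>f. sum f I) ` Pi I K" "y \<in> (\<lambda>f. sum f I) ` Pi I K"
  then obtain f g where "f \<in> Pi I K" "g \<in> Pi I K" "x = sum f I" "y = sum g I" by blast
  then show "x + y \<in> (\<lambda>f. sum f I) ` Pi I K"
    using K by (intro image_eqI[of _ _ "\<lambda>i. f i + g i"]) (auto simp: sum.distrib Pi_iff subspace_add)
next
  fix c x
  assume "x \<in> (\<lambda>f. sum f I) ` Pi I K"
  then obtain f where "f \<in> Pi I K" "x = sum f I" by blast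
  then show "scale c x \<in> (\<lambda>f. sum f I) ` Pi I K"
    using K by (intro image_eqI[of _ _ "\<lambda>i. scale c (f i)"])
      (auto simp: scale_sum_right Pi_iff subspace_scale)
qed

text \<open>
  Bounded components make the closed span \<open>L\<close> of the combined family the direct sum of the closed
  spans \<open>K i\<close>, with bounded coordinate maps \<open>x \<mapsto> Q x i\<close>. If \<open>B i\<close> orthonormalizes the \<open>i\<close>-th family,
  then the form \<open>\<Sum>i. ip (B i (Q x i)) (B i (Q y i))\<close> is equivalent to the inner product of \<open>L\<close>, and the
  combined family is orthonormal for it: two members of different families share no nonzero
  coordinate.
\<close>
lemma riesz_family_combine:
  assumes fin: "finite I"
    and C: "\<And>f i. f \<in> Pi I (\<lambda>i. closure (span (v i ` M i))) \<Longrightarrow> i \<in> I \<Longrightarrow> norm (f i) \<le> C * norm (sum f I)"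
    and riesz: "\<And>i. i \<in> I \<Longrightarrow> riesz_family (M i) (v i)"
  shows "riesz_family (SIGMA i:I. M i) (\<lambda>(i, \<alpha>). v i \<alpha>)"
proof -
  define w where "w = (\<lambda>(i, \<alpha>). v i \<alpha>)"
  define K where "K = (\<lambda>i. closure (span (v i ` M i)))"
  define L where "L = (\<lambda>f. sum f I) ` Pi I K"
  have K: "subspace (K i)" "closed (K i)" for i
    by (simp_all add: K_def subspace_closure)
  have vK: "v i \<alpha> \<in> K i" if "\<alpha> \<in> M i" for i \<alpha>
    using that by (auto simp: K_def intro: in_closed_span)
  note C = C[folded K_def]
  have L: "subspace L" "closed L"
    using subspace_sums[OF K(1)] closed_sum_of_bounded_components[OF K C]
    by (simp_all add: L_def)
  have single: "(\<lambda>j. if j = i then x else 0) \<in> Pi I K" "sum (\<lambda>j. if j = i then x else 0) I = x"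
    if "i \<in> I" "x \<in> K i" for i x
    using that fin subspace_0[OF K(1)] by (auto simp: sum.delta)
  have L_eq: "closure (span (w ` (SIGMA i:I. M i))) = L"
  proof
    have "v i \<alpha> \<in> L" if "i \<in> I" "\<alpha> \<in> M i" for i \<alpha>
      using single[OF that(1) vK[OF that(2)]] unfolding L_def by (metis (no_types) image_eqI)
    then show "closure (span (w ` (SIGMA i:I. M i))) \<subseteq> L"
      by (intro closed_span_minimal L) (auto simp: w_def)
    show "L \<subseteq> closure (span (w ` (SIGMA i:I. M i)))"
    proof
      fix x
      assume "x \<in> L"
      then obtain f where f: "f \<in> Pi I K" "x = sum f I" by (auto simp: L_def)
      have "K i \<subseteq> closure (span (w ` (SIGMA i:I. M i)))" if "i \<in> I" for i
        unfolding K_def using that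
        by (intro closure_mono span_mono) (auto simp: w_def intro!: image_eqI[of _ _ "(i, _)"])
      with f show "x \<in> closure (span (w ` (SIGMA i:I. M i)))"
        by (auto simp: Pi_iff intro!: subspace_sum subspace_closure)
    qed
  qed
  have "\<forall>x\<in>L. \<exists>f. f \<in> Pi I K \<and> sum f I = x" by (auto simp: L_def)
  then obtain Q where Q: "\<And>x. x \<in> L \<Longrightarrow> Q x \<in> Pi I K" "\<And>x. x \<in> L \<Longrightarrow> sum (Q x) I = x"
    by metis
  have Q_eqI: "Q (sum f I) i = f i" if "f \<in> Pi I K" "i \<in> I" for f i
  proof -
    have s: "sum f I \<in> L" using that by (auto simp: L_def)
    have "(\<lambda>i. Q (sum f I) i - f i) \<in> Pi I K"
      using Q(1)[OF s] that(1) by (auto simp: Pi_iff subspace_diff[OF K(1)])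
    from C[OF this that(2)] show ?thesis by (simp add: sum_subtractf Q(2)[OF s])
  qed
  have QK: "Q x i \<in> K i" if "x \<in> L" "i \<in> I" for x i using Q(1)[OF that(1)] that(2) by auto
  have Q_add: "Q (x + y) i = Q x i + Q y i" if "x \<in> L" "y \<in> L" "i \<in> I" for x y i
    using Q_eqI[of "\<lambda>i. Q x i + Q y i" i] that Q
    by (simp add: sum.distrib Pi_iff subspace_add[OF K(1)])
  have Q_scale: "Q (scale c x) i = scale c (Q x i)" if "x \<in> L" "i \<in> I" for c x i
    using Q_eqI[of "\<lambda>i. scale c (Q x i)" i] that Q
    by (simp add: scale_sum_right[symmetric] Pi_iff subspace_scale[OF K(1)])
  have "\<forall>i\<in>I. \<exists>B. isomorphism_on (K i) B \<and>
      (\<forall>\<alpha>\<in>M i. \<forall>\<beta>\<in>M i. ip (B (v i \<alpha>)) (B (v i \<beta>)) = (if \<alpha> = \<beta> then 1 else 0))"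
    using riesz unfolding riesz_family_iff_orthonormalizing_isomorphism K_def by blast
  then obtain B where B: "\<And>i. i \<in> I \<Longrightarrow> isomorphism_on (K i) (B i)"
    and on: "\<And>i \<alpha> \<beta>. i \<in> I \<Longrightarrow> \<alpha> \<in> M i \<Longrightarrow> \<beta> \<in> M i \<Longrightarrow>
      ip (B i (v i \<alpha>)) (B i (v i \<beta>)) = (if \<alpha> = \<beta> then 1 else 0)"
    by metis
  note lin = isomorphism_on_linear_into[OF B]
  have "\<forall>i\<in>I. \<exists>\<beta> \<gamma>. 0 < \<beta> \<and> 0 < \<gamma> \<and>
      (\<forall>x\<in>K i. norm (B i x) \<le> \<beta> * norm x \<and> norm x \<le> \<gamma> * norm (B i x))"
    using isomorphism_on_bounds[OF K(1) B] by metis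
  then obtain \<beta> \<gamma> where \<beta>\<gamma>: "\<And>i. i \<in> I \<Longrightarrow> 0 < \<beta> i" "\<And>i. i \<in> I \<Longrightarrow> 0 < \<gamma> i"
    and upper: "\<And>i x. i \<in> I \<Longrightarrow> x \<in> K i \<Longrightarrow> norm (B i x) \<le> \<beta> i * norm x"
    and lower: "\<And>i x. i \<in> I \<Longrightarrow> x \<in> K i \<Longrightarrow> norm x \<le> \<gamma> i * norm (B i x)"
    by metis
  define b where "b = (\<lambda>x y. \<Sum>i\<in>I. ip (B i (Q x i)) (B i (Q y i)))"
  define \<Gamma> where "\<Gamma> = (\<Sum>i\<in>I. \<gamma> i)"
  have BQ: "norm (B i (Q x i)) \<le> (\<beta> i * C) * norm x" if "i \<in> I" "x \<in> L" for i x
  proof -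
    have "norm (B i (Q x i)) \<le> \<beta> i * norm (Q x i)" using that by (intro upper QK)
    also have "\<dots> \<le> \<beta> i * (C * norm x)"
      using C[OF Q(1)[OF that(2)] that(1)] \<beta>\<gamma>(1)[OF that(1)] by (simp add: Q(2)[OF that(2)])
    finally show ?thesis by simp
  qed
  obtain A where A: "isomorphism_on L A" "\<And>x y. x \<in> L \<Longrightarrow> y \<in> L \<Longrightarrow> ip (A x) (A y) = b x y"
  proof (rule renorming[OF L, of b])
    show "b (x + y) z = b x z + b y z" if "x \<in> L" "y \<in> L" "z \<in> L" for x y z
      unfolding b_def sum.distrib[symmetric] using that
      by (intro sum.cong) (simp_all add: Q_add QK linear_into_add[OF K(1) lin] ip_add_left)
    show "b (scale a x) y = a * b x y" if "x \<in> L" "y \<in> L" for a x y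
      unfolding b_def sum_distrib_left using that
      by (intro sum.cong) (simp_all add: Q_scale QK linear_into_scale[OF K(1) lin] ip_scale_left)
    show "b x y = conjugate (b y x)" for x y
      unfolding b_def conjugate_sum by (intro sum.cong ip_commute refl)
    show "norm (b x y) \<le> (\<Sum>i\<in>I. (\<beta> i * C) * (\<beta> i * C)) * norm x * norm y"
      if "x \<in> L" "y \<in> L" for x y
    proof -
      have "norm (b x y) \<le> (\<Sum>i\<in>I. ((\<beta> i * C) * norm x) * ((\<beta> i * C) * norm y))"
        unfolding b_def
      proof (rule sum_norm_le)
        fix i
        assume i: "i \<in> I"
        have "norm (ip (B i (Q x i)) (B i (Q y i))) \<le> norm (B i (Q x i)) * norm (B i (Q y i))"
          by (rule cauchy_schwarz)
        also have "\<dots> \<le> ((\<beta> i * C) * norm x) * ((\<beta> i * C) * norm y)"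
          using BQ[OF i that(1)] BQ[OF i that(2)]
          by (intro mult_mono) (auto intro: order_trans[OF norm_ge_zero])
        finally show "norm (ip (B i (Q x i)) (B i (Q y i)))
          \<le> ((\<beta> i * C) * norm x) * ((\<beta> i * C) * norm y)" .
      qed
      also have "\<dots> = (\<Sum>i\<in>I. (\<beta> i * C) * (\<beta> i * C)) * norm x * norm y"
        unfolding sum_distrib_right by (intro sum.cong refl) (simp add: ac_simps)
      finally show ?thesis .
    qed
    \<comment> \<open>From \<open>norm x \<le> \<Gamma> * sqrt (b x x)\<close>; the summand \<open>1\<close> keeps the constant positive when \<open>I\<close> is empty.\<close>
    show "\<exists>r. b x x = of_real r \<and> 1 / (\<Gamma>\<^sup>2 + 1) * (norm x)\<^sup>2 \<le> r" if x: "x \<in> L" for x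
    proof (intro exI conjI)
      let ?r = "\<Sum>i\<in>I. (norm (B i (Q x i)))\<^sup>2"
      show "b x x = of_real ?r" by (simp add: b_def ip_self)
      have r0: "0 \<le> ?r" by (intro sum_nonneg) auto
      have "norm x \<le> (\<Sum>i\<in>I. norm (Q x i))"
        using norm_sum[of "Q x" I] by (simp add: Q(2)[OF x])
      also have "\<dots> \<le> (\<Sum>i\<in>I. \<gamma> i * sqrt ?r)"
      proof (rule sum_mono)
        fix i
        assume i: "i \<in> I"
        have "(norm (B i (Q x i)))\<^sup>2 \<le> ?r"
          using fin i by (intro member_le_sum) auto
        then have "norm (B i (Q x i)) \<le> sqrt ?r" by (rule real_le_rsqrt)
        then have "\<gamma> i * norm (B i (Q x i)) \<le> \<gamma> i * sqrt ?r"
          using \<beta>\<gamma>(2)[OF i] by simp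
        with lower[OF i QK[OF x i]] show "norm (Q x i) \<le> \<gamma> i * sqrt ?r" by simp
      qed
      also have "\<dots> = \<Gamma> * sqrt ?r" by (simp add: \<Gamma>_def sum_distrib_right)
      finally have "(norm x)\<^sup>2 \<le> (\<Gamma> * sqrt ?r)\<^sup>2" by (intro power_mono) auto
      also have "\<dots> = \<Gamma>\<^sup>2 * ?r" using r0 by (simp add: power_mult_distrib)
      also have "\<dots> \<le> (\<Gamma>\<^sup>2 + 1) * ?r" using r0 by (intro mult_right_mono) auto
      finally have "(norm x)\<^sup>2 \<le> (\<Gamma>\<^sup>2 + 1) * ?r" .
      moreover have "0 < \<Gamma>\<^sup>2 + 1" by (smt (verit) zero_le_power2)
      ultimately show "1 / (\<Gamma>\<^sup>2 + 1) * (norm x)\<^sup>2 \<le> ?r" by (simp add: field_simps)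
    qed
    show "0 < 1 / (\<Gamma>\<^sup>2 + 1)" by (smt (verit) zero_le_power2 zero_less_divide_1_iff)
  qed blast
  have wL: "w p \<in> L" if "p \<in> (SIGMA i:I. M i)" for p
    using in_closed_span[of "w p" "w ` (SIGMA i:I. M i)"] that unfolding L_eq by blast
  have b_w: "b (w p) (w r) = (if p = r then 1 else 0)"
    if pr: "p \<in> (SIGMA i:I. M i)" "r \<in> (SIGMA i:I. M i)" for p r
  proof -
    obtain i \<alpha> k \<delta> where p: "p = (i, \<alpha>)" "i \<in> I" "\<alpha> \<in> M i" and r: "r = (k, \<delta>)" "k \<in> I" "\<delta> \<in> M k"
      using pr by blast
    have Qw: "Q (v l \<epsilon>) j = (if j = l then v l \<epsilon> else 0)" if "l \<in> I" "\<epsilon> \<in> M l" "j \<in> I" for l \<epsilon> j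
      using Q_eqI[OF single(1)[OF that(1) vK[OF that(2)]] that(3)]
        single(2)[OF that(1) vK[OF that(2)]] by simp
    have "b (w p) (w r) = (\<Sum>j\<in>I. if j = i then (if i = k then ip (B i (v i \<alpha>)) (B i (v k \<delta>)) else 0) else 0)"
      unfolding b_def w_def p(1) r(1) using p r
      by (intro sum.cong refl) (auto simp: Qw linear_into_0[OF K(1) lin])
    also have "\<dots> = (if p = r then 1 else 0)"
      using p r fin on by (auto simp: sum.delta)
    finally show ?thesis .
  qed
  show ?thesis
    unfolding riesz_family_iff_orthonormalizing_isomorphism w_def[symmetric] L_eq
    using A b_w wL by (intro exI[of _ A]) auto
qed

section \<open>From a combined Riesz family to the IBAP\<close>

lemma subspace_orthogonal: "subspace {x. \<forall>y\<in>V. ip x y = 0}"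
  by (rule subspaceI) (auto simp: ip_add_left ip_scale_left)

lemma closed_orthogonal: "closed {x. \<forall>y\<in>V. ip x y = 0}"
  unfolding closed_sequential_limits
proof (intro allI impI)
  fix s l
  assume s: "(\<forall>n. s n \<in> {x. \<forall>y\<in>V. ip x y = 0}) \<and> s \<longlonglongrightarrow> l"
  have "ip l y = 0" if "y \<in> V" for y
  proof -
    have "(\<lambda>n. ip (s n) y) \<longlonglongrightarrow> ip l y" using s by (intro tendsto_ip_left) simp
    then show ?thesis using s that LIMSEQ_unique[OF tendsto_const] by fastforce
  qed
  then show "l \<in> {x. \<forall>y\<in>V. ip x y = 0}" by simp
qed

text \<open>
  Orthogonality to a fixed set is a closed linear condition; it is extended to the closed span of
  one set and then, with the roles exchanged, to that of the other.
\<close>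
lemma closed_spans_orthogonal:
  assumes "\<And>x y. x \<in> V \<Longrightarrow> y \<in> W \<Longrightarrow> ip x y = 0"
    and "x \<in> closure (span V)" "y \<in> closure (span W)"
  shows "ip x y = 0"
proof -
  have perp: "closure (span V) \<subseteq> {x. \<forall>y\<in>W. ip x y = 0}"
    using assms(1) by (intro closed_span_minimal subspace_orthogonal closed_orthogonal) auto
  have "W \<subseteq> {y. \<forall>x\<in>closure (span V). ip y x = 0}"
  proof safe
    fix y x
    assume "y \<in> W" "x \<in> closure (span V)"
    then have "ip x y = 0" using perp by blast
    then show "ip y x = 0" using ip_commute[of y x] by simp
  qed
  then have "closure (span W) \<subseteq> {y. \<forall>x\<in>closure (span V). ip y x = 0}"
    by (intro closed_span_minimal subspace_orthogonal closed_orthogonal)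
  then have "ip y x = 0" using assms(2,3) by blast
  then show ?thesis using ip_commute[of x y] by simp
qed

text \<open>
  The isomorphism \<open>B\<close> maps the \<open>H k\<close> into subspaces \<open>E k\<close> that are mutually orthogonal, where
  prescribing projections is trivial: one adds up the prescribed vectors. To transport the problem,
  with \<open>A\<close> the inverse of \<open>B\<close>, represent on \<open>E k\<close> the functional \<open>z \<mapsto> ip (A z) (x k)\<close> by a vector
  \<open>u k\<close>, and then on \<open>K\<close> the functional \<open>z \<mapsto> ip (B z) (\<Sum>k. u k)\<close> by a vector \<open>y\<close>. For \<open>h\<close> in \<open>H k\<close>
  orthogonality leaves \<open>ip h y = ip (B h) (u k) = ip h (x k)\<close>.
\<close>
lemma IBAP_if_riesz_family:
  assumes H: "\<And>i. i \<in> {1..n} \<Longrightarrow> subspace (H i)"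
    and dense: "\<And>i. i \<in> {1..n} \<Longrightarrow> H i \<subseteq> closure (span (v i ` M i))"
    and riesz: "riesz_family (SIGMA i:{1..n}. M i) (\<lambda>(i, \<alpha>). v i \<alpha>)"
  shows "IBAP n H"
  unfolding IBAP_def
proof (intro allI impI)
  fix x
  assume x: "\<forall>k\<in>{1..n}. x k \<in> H k"
  define w where "w = (\<lambda>(i, \<alpha>). v i \<alpha>)"
  define K where "K = closure (span (w ` (SIGMA i:{1..n}. M i)))"
  have K: "subspace K" "closed K" by (simp_all add: K_def subspace_closure)
  obtain B where B: "isomorphism_on K B"
    and on: "\<And>p r. p \<in> (SIGMA i:{1..n}. M i) \<Longrightarrow> r \<in> (SIGMA i:{1..n}. M i) \<Longrightarrow>
      ip (B (w p)) (B (w r)) = (if p = r then 1 else 0)"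
    using riesz unfolding riesz_family_iff_orthonormalizing_isomorphism w_def[symmetric] K_def
    by blast
  note linB = isomorphism_on_linear_into[OF B]
  define A where "A = inv_into K B"
  have linA: "linear_into K A" and isoA: "isomorphism_on K A"
    using isomorphism_on_inv_into[OF K(1) B] isomorphism_on_linear_into by (auto simp: A_def)
  have AB: "A (B z) = z" if "z \<in> K" for z
    using B that by (auto simp: A_def isomorphism_on_def bij_betw_def)
  obtain \<beta> where \<beta>: "\<And>z. z \<in> K \<Longrightarrow> norm (B z) \<le> \<beta> * norm z"
    using isomorphism_on_bounds[OF K(1) B] by metis
  obtain \<gamma> where \<gamma>: "\<And>z. z \<in> K \<Longrightarrow> norm (A z) \<le> \<gamma> * norm z"
    using isomorphism_on_bounds[OF K(1) isoA] by metis
  define E where "E = (\<lambda>i. closure (span (B ` v i ` M i)))"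
  have vK: "v i ` M i \<subseteq> K" if "i \<in> {1..n}" for i
    using that by (auto simp: K_def w_def intro!: in_closed_span image_eqI[of _ _ "(i, _)"])
  have E: "subspace (E i)" "closed (E i)" for i by (simp_all add: E_def subspace_closure)
  have EK: "E i \<subseteq> K" if "i \<in> {1..n}" for i
    unfolding E_def using vK[OF that] linear_into_mem[OF K(1) linB]
    by (intro closed_span_minimal K) auto
  have HK: "H i \<subseteq> K" if "i \<in> {1..n}" for i
    using dense[OF that] closed_span_minimal[OF K vK[OF that]] by blast
  have BH: "B h \<in> E i" if "i \<in> {1..n}" "h \<in> H i" for i h
  proof -
    have "B ` closure (span (v i ` M i)) \<subseteq> E i"
      unfolding E_def using B vK[OF that(1)]
      by (intro linear_into_image_closed_span[OF K linB]) (auto simp: isomorphism_on_def)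
    then show ?thesis using dense that by blast
  qed
  have orth: "ip y z = 0" if "i \<in> {1..n}" "j \<in> {1..n}" "i \<noteq> j" "y \<in> E i" "z \<in> E j" for i j y z
  proof (rule closed_spans_orthogonal)
    show "y \<in> closure (span (B ` v i ` M i))" "z \<in> closure (span (B ` v j ` M j))"
      using that by (simp_all add: E_def)
    fix s t
    assume "s \<in> B ` v i ` M i" "t \<in> B ` v j ` M j"
    then obtain \<sigma> \<tau> where "\<sigma> \<in> M i" "s = B (w (i, \<sigma>))" "\<tau> \<in> M j" "t = B (w (j, \<tau>))"
      by (auto simp: w_def)
    then show "ip s t = 0" using on[of "(i, \<sigma>)" "(j, \<tau>)"] that(1-3) by simp
  qed
  have "\<exists>u\<in>E k. \<forall>z\<in>E k. ip (A z) (x k) = ip z u" if k: "k \<in> {1..n}" for k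
  proof (rule riesz_representation[OF E, of k "\<lambda>z. ip (A z) (x k)" "\<gamma> * norm (x k)"])
    have A: "z \<in> K" if "z \<in> E k" for z using EK[OF k] that by blast
    show "ip (A (y + z)) (x k) = ip (A y) (x k) + ip (A z) (x k)" if "y \<in> E k" "z \<in> E k" for y z
      using that by (simp add: A linear_into_add[OF K(1) linA] ip_add_left)
    show "ip (A (scale c z)) (x k) = c * ip (A z) (x k)" if "z \<in> E k" for c z
      using that by (simp add: A linear_into_scale[OF K(1) linA] ip_scale_left)
    show "norm (ip (A z) (x k)) \<le> \<gamma> * norm (x k) * norm z" if "z \<in> E k" for z
      using order_trans[OF cauchy_schwarz mult_right_mono[OF \<gamma>[OF A[OF that]] norm_ge_zero],
          of "x k"] by (simp add: ac_simps)
  qed auto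
  then obtain u where uE: "\<And>k. k \<in> {1..n} \<Longrightarrow> u k \<in> E k"
    and u: "\<And>k z. k \<in> {1..n} \<Longrightarrow> z \<in> E k \<Longrightarrow> ip (A z) (x k) = ip z (u k)" by metis
  define s where "s = sum u {1..n}"
  obtain y where y: "\<And>z. z \<in> K \<Longrightarrow> ip (B z) s = ip z y"
  proof (rule riesz_representation[OF K, of "\<lambda>z. ip (B z) s" "\<beta> * norm s"])
    show "norm (ip (B z) s) \<le> \<beta> * norm s * norm z" if "z \<in> K" for z
      using order_trans[OF cauchy_schwarz mult_right_mono[OF \<beta>[OF that] norm_ge_zero], of s]
      by (simp add: ac_simps)
  qed (auto simp: linear_into_add[OF K(1) linB] linear_into_scale[OF K(1) linB]
      ip_add_left ip_scale_left)
  have "orth_proj (H k) y = x k" if k: "k \<in> {1..n}" for k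
  proof (rule orth_proj_eqI[OF H[OF k]])
    show "x k \<in> H k" using x k by blast
    fix h
    assume h: "h \<in> H k"
    then have hK: "h \<in> K" using HK[OF k] by blast
    have "ip h y = (\<Sum>i\<in>{1..n}. ip (B h) (u i))"
      using y[OF hK] by (simp add: s_def ip_sum_right)
    also have "\<dots> = (\<Sum>i\<in>{1..n}. if i = k then ip (B h) (u k) else 0)"
      using orth[OF k _ _ BH[OF k h] uE] by (intro sum.cong) auto
    also have "\<dots> = ip (B h) (u k)" using k by (simp add: sum.delta)
    also have "\<dots> = ip h (x k)" using u[OF k BH[OF k h]] by (simp add: AB[OF hK])
    finally have "ip h (y - x k) = 0" by (simp add: ip_diff_right)
    then show "ip (y - x k) h = 0" using ip_commute[of "y - x k" h] by simp
  qed
  then show "\<exists>y. \<forall>k\<in>{1..n}. orth_proj (H k) y = x k" by blast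
qed

end

theorem theorem4p1:
  fixes scale :: "'k::real_or_complex \<Rightarrow> 'h::{real_normed_vector, complete_space} \<Rightarrow> 'h"
    and ip :: "'h \<Rightarrow> 'h \<Rightarrow> 'k"
    and n :: nat
    and H :: "nat \<Rightarrow> 'h set"
    and M :: "nat \<Rightarrow> 'i set"
    and v :: "nat \<Rightarrow> 'i \<Rightarrow> 'h"
  assumes "hilbert_space scale ip"
    and "\<forall>i\<in>{1..n}. module.subspace scale (H i) \<and> closed (H i)"
  shows
    "(hilbert_space.IBAP ip n H \<and>
      (\<forall>i\<in>{1..n}. (\<forall>\<alpha>\<in>M i. v i \<alpha> \<in> H i) \<and> hilbert_space.riesz_family scale ip (M i) (v i))
      \<longrightarrow> hilbert_space.riesz_family scale ip (SIGMA i:{1..n}. M i) (\<lambda>(i, \<alpha>). v i \<alpha>))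
     \<and>
     ((\<forall>i\<in>{1..n}. (\<forall>\<alpha>\<in>M i. v i \<alpha> \<in> H i) \<and> H i \<subseteq> closure (module.span scale (v i ` M i))) \<and>
      hilbert_space.riesz_family scale ip (SIGMA i:{1..n}. M i) (\<lambda>(i, \<alpha>). v i \<alpha>)
      \<longrightarrow> hilbert_space.IBAP ip n H)"
proof -
  interpret hilbert_space scale ip by (rule assms(1))
  have H: "\<And>i. i \<in> {1..n} \<Longrightarrow> subspace (H i)" "\<And>i. i \<in> {1..n} \<Longrightarrow> closed (H i)"
    using assms(2) by auto
  show ?thesis
  proof (intro conjI impI; elim conjE)
    assume ibap: "IBAP n H"
      and v: "\<forall>i\<in>{1..n}. (\<forall>\<alpha>\<in>M i. v i \<alpha> \<in> H i) \<and> riesz_family (M i) (v i)"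
    obtain C where C: "\<And>f k. f \<in> Pi {1..n} H \<Longrightarrow> k \<in> {1..n} \<Longrightarrow>
        norm (f k) \<le> C * norm (sum f {1..n})"
      using IBAP_imp_components_bounded[OF ibap H] by blast
    have "closure (span (v i ` M i)) \<subseteq> H i" if "i \<in> {1..n}" for i
      using v that H by (intro closed_span_minimal) auto
    then have "Pi {1..n} (\<lambda>i. closure (span (v i ` M i))) \<subseteq> Pi {1..n} H"
      by (intro Pi_mono)
    with C v show "riesz_family (SIGMA i:{1..n}. M i) (\<lambda>(i, \<alpha>). v i \<alpha>)"
      by (intro riesz_family_combine[of _ _ _ C]) blast+
  next
    assume "\<forall>i\<in>{1..n}. (\<forall>\<alpha>\<in>M i. v i \<alpha> \<in> H i) \<and> H i \<subseteq> closure (span (v i ` M i))"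
      and "riesz_family (SIGMA i:{1..n}. M i) (\<lambda>(i, \<alpha>). v i \<alpha>)"
    with H(1) show "IBAP n H" by (intro IBAP_if_riesz_family) blast+
  qed
qed

end
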